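(* For every finite simple graph $G$, $\chi(G)\le h_1(D(G))$.
   Context: All graphs are finite and simple (no loops, no parallel edges). $D(G)$ denotes the degree sequence (multiset of vertex degrees) of $G$, and for a degree sequence $D$, ${\cal R}(D)$ is the set of all simple graphs whose degree sequence is $D$. For a graph $H$, $h_1(H)$ is the largest integer $r$ such that $H$ contains a subgraph obtained from the complete graph $K_r$ by first selecting vertex-disjoint subgraphs $S_1,\dots,S_a$ of $K_r$, each $S_i$ isomorphic to a star $K_{1,n_i}$, and then subdividing each edge of these stars exactly once (all other edges of $K_r$ remain unsubdivided). For a degree sequence $D$, $h_1(D)=\max\{h_1(H): H\in{\cal R}(D)\}$. $\chi(G)$ is the chromatic number. *)

theory Defs
  imports "Graph_Theory.Graph_Theory" "HOL-Library.Multiset"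
begin

text \<open>
  Finite simple graphs are the finite, symmetric, loopfree pair digraphs (locale
  \<^locale>\<open>pair_graph\<close>): an undirected edge \<open>uv\<close> is the pair of arcs \<open>(u, v)\<close>, \<open>(v, u)\<close>, so
  the degree of a vertex is its out-degree.
\<close>

definition degree_sequence :: "'a pair_pre_digraph \<Rightarrow> nat multiset" where
  "degree_sequence G = image_mset (out_degree (with_proj G)) (mset_set (pverts G))"

text \<open>
  Taking the vertices in \<^typ>\<open>nat\<close> loses nothing: every finite graph is isomorphic to
  one of these.
\<close>

definition realizations :: "nat multiset \<Rightarrow> nat pair_pre_digraph set" where
  "realizations D = {H. pair_graph H \<and> degree_sequence H = D}"

definition proper_coloring :: "'a pair_pre_digraph \<Rightarrow> nat \<Rightarrow> ('a \<Rightarrow> nat) \<Rightarrow> bool" where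
  "proper_coloring G k c \<longleftrightarrow>
     (\<forall>v\<in>pverts G. c v < k) \<and> (\<forall>(u, v)\<in>parcs G. c u \<noteq> c v)"

definition chromatic_number :: "'a pair_pre_digraph \<Rightarrow> nat" where
  "chromatic_number G = (LEAST k. \<exists>c. proper_coloring G k c)"

text \<open>
  \<open>T\<close> arises from \<open>K\<close> by subdividing each edge in the symmetric arc set \<open>F\<close> exactly once.
  The new vertex on the edge \<open>uv\<close> is \<open>w {u, v}\<close>; indexing by the unordered pair gives both
  arcs of an edge the same new vertex.
\<close>

definition subdivided_once ::
  "'a pair_pre_digraph \<Rightarrow> 'a rel \<Rightarrow> 'a pair_pre_digraph \<Rightarrow> bool" where
  "subdivided_once K F T \<longleftrightarrow> F \<subseteq> parcs K \<and> sym F \<and>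
     (\<exists>w :: 'a set \<Rightarrow> 'a.
        inj_on w {{u, v} |u v. (u, v) \<in> F} \<and>
        (\<forall>(u, v)\<in>F. w {u, v} \<notin> pverts K) \<and>
        pverts T = pverts K \<union> {w {u, v} |u v. (u, v) \<in> F} \<and>
        parcs T = (parcs K - F) \<union> {(u, w {u, v}) |u v. (u, v) \<in> F}
                                \<union> {(w {u, v}, u) |u v. (u, v) \<in> F})"

definition star_subdivided_complete :: "nat \<Rightarrow> 'a pair_pre_digraph \<Rightarrow> bool" where
  "star_subdivided_complete r T \<longleftrightarrow>
     (\<exists>K \<S>. complete_digraph r (with_proj K) \<and>
        (\<forall>S\<in>\<S>. subgraph (with_proj S) (with_proj K) \<and>
                (\<exists>n. complete_bipartite_digraph 1 n (with_proj S))) \<and>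
        pairwise (\<lambda>S S'. pverts S \<inter> pverts S' = {}) \<S> \<and>
        subdivided_once K (\<Union>S\<in>\<S>. parcs S) T)"

definition h1 :: "'a pair_pre_digraph \<Rightarrow> nat" where
  "h1 H = Max {r. \<exists>T. subgraph (with_proj T) (with_proj H) \<and> star_subdivided_complete r T}"

definition h1_seq :: "nat multiset \<Rightarrow> nat" where
  "h1_seq D = Max (h1 ` realizations D)"

text \<open>The minimum and the maxima above are attained.\<close>

lemma proper_coloring_exists:
  assumes "pair_graph G"
  shows "\<exists>k c. proper_coloring G k c"
proof -
  interpret pair_graph G by fact
  obtain f :: "'a \<Rightarrow> nat" and n where f: "f ` pverts G = {i. i < n}" "inj_on f (pverts G)"
    using finite_imp_inj_to_nat_seg[OF pair_finite_verts] by blast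
  have "proper_coloring G n f"
    unfolding proper_coloring_def
  proof (intro conjI ballI)
    fix v assume "v \<in> pverts G" then show "f v < n" using f(1) by blast
  next
    fix e assume e: "e \<in> parcs G"
    then have "f (fst e) \<noteq> f (snd e)"
      using f(2) pair_no_loops[OF e] arc_fst_in_verts[OF e] arc_snd_in_verts[OF e]
      by (meson inj_onD)
    then show "case e of (u, v) \<Rightarrow> f u \<noteq> f v" by (simp add: case_prod_beta)
  qed
  then show ?thesis by blast
qed

lemma star_subdivided_complete_le_card:
  assumes "pair_graph H" "subgraph (with_proj T) (with_proj H)" "star_subdivided_complete r T"
  shows "r \<le> card (pverts H)"
proof -
  interpret pair_graph H by fact
  obtain K F where K: "complete_digraph r (with_proj K)" and T: "subdivided_once K F T"
    using assms(3) unfolding star_subdivided_complete_def by blast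
  have "card (pverts K) = r" using K by (simp add: complete_digraph_pair_def)
  moreover have "pverts K \<subseteq> pverts T" using T unfolding subdivided_once_def by blast
  moreover have "pverts T \<subseteq> pverts H" using assms(2) by (auto simp: subgraph_def)
  ultimately show ?thesis using card_mono[OF pair_finite_verts] by (metis order_trans)
qed

lemma h1_candidates:
  fixes H :: "'a pair_pre_digraph"
  assumes "pair_graph H"
  defines "R \<equiv> {r. \<exists>T. subgraph (with_proj T) (with_proj H) \<and> star_subdivided_complete r T}"
  shows "finite R" "R \<noteq> {}" "h1 H \<in> R" "h1 H \<le> card (pverts H)"
proof -
  have le: "r \<le> card (pverts H)" if "r \<in> R" for r
    using that star_subdivided_complete_le_card[OF assms(1)] by (auto simp: R_def)
  show fin: "finite R"
    by (rule finite_subset[of _ "{..card (pverts H)}"]) (use le in auto)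
  let ?N = "\<lparr>pverts = {}, parcs = {}\<rparr> :: 'a pair_pre_digraph"
  have "complete_digraph 0 (with_proj ?N)" by (simp add: complete_digraph_pair_def)
  then have "star_subdivided_complete 0 ?N"
    unfolding star_subdivided_complete_def
    by (intro exI[of _ ?N] exI[of _ "{}"]) (simp add: subdivided_once_def sym_def)
  moreover have "subgraph (with_proj ?N) (with_proj H)"
  proof -
    interpret pair_graph H by fact
    have "wf_digraph (with_proj ?N)" by unfold_locales auto
    then show ?thesis
      using wf_digraph_axioms by (simp add: subgraph_def compatible_def)
  qed
  ultimately have "0 \<in> R" by (auto simp: R_def)
  then show ne: "R \<noteq> {}" by auto
  show "h1 H \<in> R" unfolding h1_def R_def[symmetric] using fin ne by (rule Max_in)
  then show "h1 H \<le> card (pverts H)" by (rule le)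
qed

lemma finite_h1_realizations: "finite (h1 ` realizations D)"
proof -
  have "h1 H \<le> size D" if "H \<in> realizations D" for H
    using that h1_candidates(4)[of H] by (auto simp: realizations_def degree_sequence_def)
  then show ?thesis by (auto intro: finite_subset[where B = "{..size D}"])
qed

lemma realizations_nonempty:
  assumes "pair_graph G"
  shows "realizations (degree_sequence G) \<noteq> {}"
proof -
  interpret G: pair_graph G by fact
  obtain f :: "'a \<Rightarrow> nat" where f: "inj_on f (pverts G)"
    using finite_imp_inj_to_nat_seg[OF G.pair_finite_verts] by blast
  define H where "H = \<lparr>pverts = f ` pverts G, parcs = map_prod f f ` parcs G\<rparr>"
  have s: "sym (parcs G)" using G.pair_sym_arcs by (simp add: symmetric_def)
  have "pair_graph H"
  proof
    fix e assume "e \<in> parcs H"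
    then obtain u v where "(u, v) \<in> parcs G" "e = (f u, f v)" by (auto simp: H_def)
    then show "fst e \<in> pverts H" "snd e \<in> pverts H" "fst e \<noteq> snd e"
      using inj_onD[OF f, of u v] G.in_arcsD1[of u v] G.in_arcsD2[of u v]
        G.pair_no_loops[of "(u, v)"]
      by (auto simp: H_def)
  next
    show "finite (pverts H)" "finite (parcs H)"
      using G.pair_finite_verts G.pair_finite_arcs by (auto simp: H_def)
    show "symmetric (with_proj H)"
      using s unfolding symmetric_def with_proj_simps sym_def H_def by force
  qed
  moreover have "out_degree (with_proj H) (f v) = out_degree (with_proj G) v"
    if v: "v \<in> pverts G" for v
  proof -
    have "out_arcs (with_proj H) (f v) = map_prod f f ` out_arcs (with_proj G) v"
    proof (intro set_eqI iffI)
      fix e assume "e \<in> out_arcs (with_proj H) (f v)"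
      then obtain a b where ab: "(a, b) \<in> parcs G" "e = (f a, f b)" "f a = f v"
        by (auto simp: out_arcs_def H_def)
      then have "a = v" using v f G.in_arcsD1 by (meson inj_onD)
      then show "e \<in> map_prod f f ` out_arcs (with_proj G) v"
        using ab by (auto simp: out_arcs_def)
    next
      fix e assume "e \<in> map_prod f f ` out_arcs (with_proj G) v"
      then show "e \<in> out_arcs (with_proj H) (f v)" by (auto simp: out_arcs_def H_def)
    qed
    moreover have "inj_on (map_prod f f) (out_arcs (with_proj G) v)"
      by (rule inj_on_subset[OF map_prod_inj_on[OF f f]])
        (auto simp: out_arcs_def dest: G.in_arcsD1 G.in_arcsD2)
    ultimately show ?thesis by (simp add: out_degree_def card_image)
  qed
  then have "degree_sequence H = degree_sequence G"
    using G.pair_finite_verts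
    by (auto simp: degree_sequence_def H_def image_mset_mset_set[OF f, symmetric]
        multiset.map_comp intro!: image_mset_cong)
  ultimately show ?thesis by (auto simp: realizations_def)
qed

end

theory Submission
  imports Defs
begin

text \<open>A clique alone cannot be expected: the 5-cycle has chromatic number 3, every graph with
  its degree sequence is again a 5-cycle, and this is a triangle with two edges at one vertex
  subdivided. Its order is 2k - 1 for k = 3, the exceptional case. The bound 2k - 1 enters because
  it makes \<open>V - A\<close> smaller than \<open>A\<close> by at most one: a stuck exchange
  forces more than \<open>|V - A|\<close> vertices of \<open>A\<close> to miss a saturated vertex or
  the one being raised, hence all of \<open>A\<close>, and \<open>|V - A| = k - 1\<close>. Working
  by decreasing degree gives each saturated vertex a degree above the current degree of the vertex
  being raised, hence neighbours whose edges can be traded. Parts of a join inherit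
  vertex-criticality because the chromatic number is additive over joins; criticality yields the
  minimum degree k - 1 in each part, and the branch vertices found in the parts add up to the
  chromatic number, with at most one nontrivial star per part.\<close>

text \<open>
  Gallai: a vertex-critical graph splits as a join of vertex-critical parts \<open>C\<close> with
  \<open>|C| \<ge> 2\<chi>(C) - 1\<close>. Since the parts are completely joined, it suffices to rearrange the edges inside
  each part, keeping all degrees. So let a graph on \<open>n \<ge> 2k - 1\<close> vertices have minimum degree at least
  \<open>k - 1\<close>, and let \<open>A\<close> consist of \<open>k\<close> vertices of largest degree. Make \<open>A\<close> a clique, at the cost of
  degrees outside \<open>A\<close>, and restore those degrees greedily by short edge exchanges in the style of the
  Tripathi-Venugopalan-West proof of the Erdos-Gallai theorem. Counting shows that this can only get
  stuck if \<open>n = 2k - 1\<close>. In that case make \<open>V - A\<close> a clique as well and balance the edges between the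
  two cliques until an even set \<open>D\<close> of vertices outside \<open>A\<close> lacks exactly one edge each; then
  rerouting edges \<open>u a\<close> inside \<open>A\<close> through the vertices of \<open>D\<close>, and deleting a perfect matching of \<open>D\<close>,
  gives the right degrees and a clique on \<open>A\<close> in which one star with centre \<open>u\<close> is subdivided.
\<close>

section \<open>Hall's theorem\<close>

text \<open>Halmos-Vaughan argument: a tight proper subfamily \<open>J\<close> is represented on its
  own and its union is removed from the other sets; if no subfamily is tight, a representative of
  one set may be fixed arbitrarily, since every other union shrinks by at most one element.\<close>

lemma hall_transversal:
  fixes S :: "'i \<Rightarrow> 'b set"
  assumes "finite I" and "\<And>i. i \<in> I \<Longrightarrow> finite (S i)"
    and "\<And>J. J \<subseteq> I \<Longrightarrow> card J \<le> card (\<Union>(S ` J))"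
  shows "\<exists>f. inj_on f I \<and> (\<forall>i\<in>I. f i \<in> S i)"
  using assms
proof (induction "card I" arbitrary: I S rule: less_induct)
  case less
  note fin = less.prems(1) and finS = less.prems(2) and hall = less.prems(3)
  show ?case
  proof (cases "I = {}")
    case True
    then show ?thesis by simp
  next
    case False
    show ?thesis
    proof (cases "\<exists>J. J \<subset> I \<and> J \<noteq> {} \<and> card (\<Union>(S ` J)) = card J")
      case True
      then obtain J where J: "J \<subset> I" "J \<noteq> {}" "card (\<Union>(S ` J)) = card J" by blast
      have finJ: "finite J" using J(1) fin finite_subset by blast
      have fU: "finite (\<Union>(S ` J))" using finJ finS J(1) by blast
      have "\<exists>f. inj_on f J \<and> (\<forall>i\<in>J. f i \<in> S i)"
        using J(1) hall finS finJ by (intro less.hyps psubset_card_mono[OF fin]) auto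
      then obtain f where f: "inj_on f J" "\<forall>i\<in>J. f i \<in> S i" by blast
      define S' where "S' i = S i - \<Union>(S ` J)" for i
      have "\<exists>g. inj_on g (I - J) \<and> (\<forall>i\<in>I - J. g i \<in> S' i)"
      proof (rule less.hyps)
        show "card (I - J) < card I" using J(1,2) fin by (intro psubset_card_mono) auto
        show "finite (I - J)" using fin by simp
        show "finite (S' i)" if "i \<in> I - J" for i using that finS by (simp add: S'_def)
        fix K assume K: "K \<subseteq> I - J"
        then have finK: "finite K" using fin finite_subset by blast
        have fK: "finite (\<Union>(S ` K))" using finK finS K by blast
        have eq: "\<Union>(S ` (J \<union> K)) = \<Union>(S ` J) \<union> \<Union>(S' ` K)" by (auto simp: S'_def)
        have "card J + card K = card (J \<union> K)"
          using K finJ finK by (intro card_Un_disjoint[symmetric]) auto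
        also have "\<dots> \<le> card (\<Union>(S ` (J \<union> K)))" using K J(1) by (intro hall) auto
        also have "\<dots> \<le> card (\<Union>(S ` J)) + card (\<Union>(S' ` K))"
          unfolding eq by (rule card_Un_le)
        finally show "card K \<le> card (\<Union>(S' ` K))" using J(3) by simp
      qed
      then obtain g where g: "inj_on g (I - J)" "\<forall>i\<in>I - J. g i \<in> S' i" by blast
      let ?h = "\<lambda>i. if i \<in> J then f i else g i"
      have cross: "f i \<noteq> g j" if "i \<in> J" "j \<in> I - J" for i j
        using that f(2) g(2) by (force simp: S'_def)
      have "inj_on ?h I"
      proof (rule inj_onI)
        fix x y assume "x \<in> I" "y \<in> I" "?h x = ?h y"
        then show "x = y"
          using cross[of x y] cross[of y x] inj_onD[OF f(1), of x y] inj_onD[OF g(1), of x y]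
          by (auto split: if_splits)
      qed
      moreover have "\<forall>i\<in>I. ?h i \<in> S i" using f(2) g(2) by (auto simp: S'_def)
      ultimately show ?thesis by blast
    next
      case False
      obtain i0 where i0: "i0 \<in> I" using \<open>I \<noteq> {}\<close> by blast
      have "S i0 \<noteq> {}" using hall[of "{i0}"] i0 by auto
      then obtain x where x: "x \<in> S i0" by blast
      define S' where "S' i = S i - {x}" for i
      have "\<exists>g. inj_on g (I - {i0}) \<and> (\<forall>i\<in>I - {i0}. g i \<in> S' i)"
      proof (rule less.hyps)
        show "card (I - {i0}) < card I" using i0 fin by (meson card_Diff1_less)
        show "finite (I - {i0})" using fin by simp
        show "finite (S' i)" if "i \<in> I - {i0}" for i using that finS by (simp add: S'_def)
        fix K assume K: "K \<subseteq> I - {i0}"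
        show "card K \<le> card (\<Union>(S' ` K))"
        proof (cases "K = {}")
          case False
          have "K \<subset> I" using K i0 by blast
          then have "card (\<Union>(S ` K)) \<noteq> card K" using \<open>\<not> (\<exists>J. _ J)\<close> False by blast
          moreover have "card K \<le> card (\<Union>(S ` K))" using K by (intro hall) auto
          ultimately have lt: "card K < card (\<Union>(S ` K))" by simp
          have "\<Union>(S' ` K) = \<Union>(S ` K) - {x}" by (auto simp: S'_def)
          then show ?thesis using lt card_Diff1_le[of "\<Union>(S ` K)" x] by (auto simp: card_Diff_singleton_if)
        qed simp
      qed
      then obtain g where g: "inj_on g (I - {i0})" "\<forall>i\<in>I - {i0}. g i \<in> S' i" by blast
      have "inj_on (g(i0 := x)) I"
      proof (rule inj_onI)
        fix y z assume "y \<in> I" "z \<in> I" "(g(i0 := x)) y = (g(i0 := x)) z"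
        then show "y = z"
          using g(2) inj_onD[OF g(1), of y z] by (auto simp: S'_def split: if_splits)
      qed
      moreover have "\<forall>i\<in>I. (g(i0 := x)) i \<in> S i" using g(2) x by (auto simp: S'_def)
      ultimately show ?thesis by blast
    qed
  qed
qed

section \<open>Critical graphs\<close>

text \<open>A graph is a set \<open>E\<close> of edges, and a vertex set \<open>W\<close> stands for
  the subgraph it induces, so deleting vertices or passing to a part never changes
  \<open>E\<close>.\<close>

definition colorable :: "'a set set \<Rightarrow> 'a set \<Rightarrow> nat \<Rightarrow> bool" where
  "colorable E W k \<longleftrightarrow>
     (\<exists>c. (\<forall>v\<in>W. c v < k) \<and> (\<forall>u\<in>W. \<forall>v\<in>W. {u, v} \<in> E \<longrightarrow> c u \<noteq> c v))"

definition chi :: "'a set set \<Rightarrow> 'a set \<Rightarrow> nat" where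
  "chi E W = (LEAST k. colorable E W k)"

definition joined :: "'a set set \<Rightarrow> 'a set \<Rightarrow> 'a set \<Rightarrow> bool" where
  "joined E X Y \<longleftrightarrow> X \<inter> Y = {} \<and> (\<forall>x\<in>X. \<forall>y\<in>Y. {x, y} \<in> E)"

text \<open>In other words, the complement of the graph on \<open>W\<close> is connected; splitting
  into irreducible parts means taking the components of the complement.\<close>

definition join_irreducible :: "'a set set \<Rightarrow> 'a set \<Rightarrow> bool" where
  "join_irreducible E W \<longleftrightarrow>
     W \<noteq> {} \<and> (\<forall>X Y. W = X \<union> Y \<longrightarrow> joined E X Y \<longrightarrow> X = {} \<or> Y = {})"

definition vertex_critical :: "'a set set \<Rightarrow> 'a set \<Rightarrow> bool" where
  "vertex_critical E W \<longleftrightarrow> (\<forall>v\<in>W. chi E (W - {v}) < chi E W)"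

text \<open>\<open>colorable\<close> also looks at \<open>{v, v}\<close>, so a singleton edge at a
  vertex of \<open>W\<close> would rule out every colouring.\<close>

locale loopfree =
  fixes E :: "'a set set"
  assumes no_loop: "{v} \<notin> E"
begin

lemma colorable_chi:
  assumes "finite W"
  shows "colorable E W (chi E W)"
proof -
  obtain f :: "'a \<Rightarrow> nat" and n where f: "f ` W = {i. i < n}" "inj_on f W"
    using finite_imp_inj_to_nat_seg[OF assms] by blast
  have "colorable E W n"
    unfolding colorable_def
  proof (intro exI conjI ballI impI)
    show "f v < n" if "v \<in> W" for v using f(1) that by blast
    fix u v assume "u \<in> W" "v \<in> W" "{u, v} \<in> E"
    then show "f u \<noteq> f v" using no_loop[of u] inj_onD[OF f(2), of u v] by auto
  qed
  then show ?thesis unfolding chi_def by (rule LeastI)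
qed

lemma chi_le: "colorable E W k \<Longrightarrow> chi E W \<le> k"
  unfolding chi_def by (rule Least_le)

section \<open>Chromatic number of subsets, unions and joins\<close>

lemma chi_empty [simp]: "chi E {} = 0"
  using chi_le[of "{}" 0] by (simp add: colorable_def)

lemma chi_mono:
  assumes "finite W'" "W \<subseteq> W'"
  shows "chi E W \<le> chi E W'"
  using colorable_chi[OF assms(1)] assms(2) unfolding colorable_def
  by (intro chi_le) (unfold colorable_def, blast)

lemma chi_Un_le:
  assumes "finite X" "finite Y"
  shows "chi E (X \<union> Y) \<le> chi E X + chi E Y"
proof -
  obtain c where c: "\<forall>v\<in>X. c v < chi E X" "\<forall>u\<in>X. \<forall>v\<in>X. {u, v} \<in> E \<longrightarrow> c u \<noteq> c v"
    using colorable_chi[OF assms(1)] unfolding colorable_def by blast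
  obtain d where d: "\<forall>v\<in>Y. d v < chi E Y" "\<forall>u\<in>Y. \<forall>v\<in>Y. {u, v} \<in> E \<longrightarrow> d u \<noteq> d v"
    using colorable_chi[OF assms(2)] unfolding colorable_def by blast
  let ?e = "\<lambda>v. if v \<in> X then c v else chi E X + d v"
  have "colorable E (X \<union> Y) (chi E X + chi E Y)"
    unfolding colorable_def
  proof (intro exI[of _ ?e] conjI ballI impI)
    show "?e v < chi E X + chi E Y" if "v \<in> X \<union> Y" for v
      using that c(1) d(1) by (auto simp: trans_less_add1)
    fix u v assume "u \<in> X \<union> Y" "v \<in> X \<union> Y" "{u, v} \<in> E"
    moreover have "c x \<noteq> chi E X + d y" if "x \<in> X" for x y
      using c(1) that by (metis not_add_less1)
    ultimately show "?e u \<noteq> ?e v" using c(2) d(2) by (auto simp: eq_commute)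
  qed
  then show ?thesis by (rule chi_le)
qed

lemma chi_insert_le:
  assumes "finite W"
  shows "chi E (insert v W) \<le> chi E W + 1"
proof -
  have "colorable E {v} 1" using no_loop[of v] by (auto simp: colorable_def)
  then show ?thesis using chi_Un_le[of W "{v}"] chi_le[of "{v}" 1] assms by simp
qed

text \<open>The two sides of a join share no colour, and each side uses at least its own chromatic
  number of colours, as renumbering the colours that occur shows.\<close>

lemma chi_join:
  assumes "finite X" "finite Y" "joined E X Y"
  shows "chi E (X \<union> Y) = chi E X + chi E Y"
proof (rule antisym[OF chi_Un_le[OF assms(1,2)]])
  obtain c where c: "\<forall>v\<in>X \<union> Y. c v < chi E (X \<union> Y)"
      "\<forall>u\<in>X \<union> Y. \<forall>v\<in>X \<union> Y. {u, v} \<in> E \<longrightarrow> c u \<noteq> c v"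
    using colorable_chi[of "X \<union> Y"] assms(1,2) unfolding colorable_def by blast
  have le: "chi E Z \<le> card (c ` Z)" if "Z \<subseteq> X \<union> Y" for Z
  proof -
    have "finite Z" using that assms(1,2) finite_subset by blast
    then obtain f where f: "bij_betw f (c ` Z) {0..<card (c ` Z)}"
      using ex_bij_betw_finite_nat by blast
    have "colorable E Z (card (c ` Z))"
      unfolding colorable_def
    proof (intro exI[of _ "f \<circ> c"] conjI ballI impI)
      show "(f \<circ> c) v < card (c ` Z)" if "v \<in> Z" for v
        using bij_betwE[OF f] that by auto
      fix u v assume uv: "u \<in> Z" "v \<in> Z" "{u, v} \<in> E"
      then have "c u \<noteq> c v" using c(2) that by blast
      then show "(f \<circ> c) u \<noteq> (f \<circ> c) v"
        using inj_onD[OF bij_betw_imp_inj_on[OF f], of "c u" "c v"] uv by auto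
    qed
    then show ?thesis by (rule chi_le)
  qed
  have disj: "c ` X \<inter> c ` Y = {}" using c(2) assms(3) unfolding joined_def by blast
  have "chi E X + chi E Y \<le> card (c ` X) + card (c ` Y)" using le[of X] le[of Y] by simp
  also have "\<dots> = card (c ` X \<union> c ` Y)"
    using disj assms(1,2) by (intro card_Un_disjoint[symmetric]) auto
  also have "\<dots> \<le> card {..<chi E (X \<union> Y)}" using c(1) by (intro card_mono) auto
  finally show "chi E X + chi E Y \<le> chi E (X \<union> Y)" by simp
qed

lemma chi_Union_le:
  assumes "finite \<C>" "\<And>C. C \<in> \<C> \<Longrightarrow> finite (F C)"
  shows "chi E (\<Union>C\<in>\<C>. F C) \<le> (\<Sum>C\<in>\<C>. chi E (F C))"
  using assms
proof (induction \<C> rule: finite_induct)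
  case (insert C \<C>)
  have "chi E (F C \<union> (\<Union>C\<in>\<C>. F C)) \<le> chi E (F C) + chi E (\<Union>C\<in>\<C>. F C)"
    using insert by (intro chi_Un_le) auto
  then show ?case using insert by auto
qed simp

lemma chi_Union_join:
  assumes "finite \<C>" "\<And>C. C \<in> \<C> \<Longrightarrow> finite C" "pairwise (joined E) \<C>"
  shows "chi E (\<Union>\<C>) = (\<Sum>C\<in>\<C>. chi E C)"
  using assms
proof (induction \<C> rule: finite_induct)
  case (insert C \<C>)
  have "joined E C (\<Union>\<C>)"
    using insert.prems(2) insert.hyps(2) by (auto simp: pairwise_def joined_def)
  then have "chi E (C \<union> \<Union>\<C>) = chi E C + chi E (\<Union>\<C>)"
    using insert by (intro chi_join) auto
  then show ?case using insert by (auto simp: pairwise_insert)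
qed simp

text \<open>Otherwise a colouring of \<open>W - {v}\<close> with \<open>chi E W - 1\<close> colours
  misses one of them on the neighbours of \<open>v\<close>, and \<open>v\<close> can take
  it.\<close>

lemma degree_ge_of_critical:
  assumes "finite W" "vertex_critical E W" "v \<in> W"
  shows "chi E W \<le> card {w \<in> W. {v, w} \<in> E} + 1"
proof (rule ccontr)
  let ?N = "{w \<in> W. {v, w} \<in> E}"
  assume "\<not> ?thesis"
  then have lt: "card ?N + 1 < chi E W" by simp
  have fin: "finite (W - {v})" using assms(1) by simp
  obtain c where c: "\<forall>u\<in>W - {v}. c u < chi E (W - {v})"
      "\<forall>u\<in>W - {v}. \<forall>w\<in>W - {v}. {u, w} \<in> E \<longrightarrow> c u \<noteq> c w"
    using colorable_chi[OF fin] unfolding colorable_def by blast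
  have lt': "chi E (W - {v}) < chi E W" using assms unfolding vertex_critical_def by blast
  have "card (c ` ?N) < card {..<chi E W - 1}"
    using lt card_image_le[of ?N c] assms(1) by simp
  then have "\<not> {..<chi E W - 1} \<subseteq> c ` ?N"
    using card_mono[of "c ` ?N" "{..<chi E W - 1}"] assms(1) by fastforce
  then obtain k where k: "k < chi E W - 1" "k \<notin> c ` ?N" by blast
  have "colorable E W (chi E W - 1)"
    unfolding colorable_def
  proof (intro exI[of _ "c(v := k)"] conjI ballI impI)
    show "(c(v := k)) u < chi E W - 1" if "u \<in> W" for u
      using that c(1)[rule_format, of u] lt' k(1) by (cases "u = v") auto
    fix u w assume "u \<in> W" "w \<in> W" "{u, w} \<in> E"
    then show "(c(v := k)) u \<noteq> (c(v := k)) w"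
      using c(2) k(2) no_loop[of v] by (auto simp: insert_commute)
  qed
  then have "chi E W \<le> chi E W - 1" by (rule chi_le)
  then show False using lt by simp
qed

text \<open>A smallest subset with chromatic number at least \<open>k\<close> works: deleting a
  vertex lowers the chromatic number by at most one, so it cannot exceed \<open>k\<close>.\<close>

lemma critical_subset:
  assumes "finite W" "k \<le> chi E W"
  shows "\<exists>W0\<subseteq>W. vertex_critical E W0 \<and> chi E W0 = k"
proof -
  let ?P = "\<lambda>W'. W' \<subseteq> W \<and> k \<le> chi E W'"
  obtain W0 where W0: "?P W0" "\<And>W'. ?P W' \<Longrightarrow> card W0 \<le> card W'"
    using ex_has_least_nat[of ?P W card] assms(2) by blast
  have fin: "finite W0" using W0(1) assms(1) finite_subset by blast
  have lt: "chi E (W0 - {v}) < k" if "v \<in> W0" for v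
  proof (rule ccontr)
    assume "\<not> ?thesis"
    then have "card W0 \<le> card (W0 - {v})" using W0(1) by (intro W0(2)) auto
    then show False using that fin by (meson card_Diff1_less not_le)
  qed
  have "chi E W0 = k"
  proof (cases "W0 = {}")
    case False
    then obtain v where v: "v \<in> W0" by blast
    then have "chi E W0 \<le> chi E (W0 - {v}) + 1"
      using chi_insert_le[of "W0 - {v}" v] fin by (simp add: insert_absorb)
    then show ?thesis using lt[OF v] W0(1) by simp
  qed (use W0(1) in simp)
  then show ?thesis using W0(1) lt unfolding vertex_critical_def by blast
qed

lemma vertex_critical_joinL:
  assumes "finite X" "finite Y" "joined E X Y" "vertex_critical E (X \<union> Y)"
  shows "vertex_critical E X"
  unfolding vertex_critical_def
proof
  fix v assume v: "v \<in> X"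
  then have eq: "(X \<union> Y) - {v} = (X - {v}) \<union> Y" using assms(3) by (auto simp: joined_def)
  have "joined E (X - {v}) Y" using assms(3) by (auto simp: joined_def)
  then have "chi E ((X \<union> Y) - {v}) = chi E (X - {v}) + chi E Y"
    unfolding eq using assms by (intro chi_join) auto
  moreover have "chi E ((X \<union> Y) - {v}) < chi E (X \<union> Y)"
    using assms(4) v unfolding vertex_critical_def by blast
  ultimately show "chi E (X - {v}) < chi E X" using chi_join[OF assms(1-3)] by simp
qed

lemma joined_commute: "joined E X Y \<longleftrightarrow> joined E Y X"
  unfolding joined_def by (metis inf_commute insert_commute)

lemma critical_join_decomposition:
  assumes "finite W" "vertex_critical E W"
  shows "\<exists>\<C>. \<Union>\<C> = W \<and> pairwise (joined E) \<C> \<and>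
    (\<forall>C\<in>\<C>. join_irreducible E C \<and> vertex_critical E C)"
  using assms
proof (induction "card W" arbitrary: W rule: less_induct)
  case less
  show ?case
  proof (cases "W = {} \<or> join_irreducible E W")
    case True
    then show ?thesis
      using less.prems by (auto intro: exI[of _ "{}"] exI[of _ "{W}"] simp: pairwise_def)
  next
    case False
    then obtain X Y where XY: "W = X \<union> Y" "joined E X Y" "X \<noteq> {}" "Y \<noteq> {}"
      unfolding join_irreducible_def by blast
    have fin: "finite X" "finite Y" using XY(1) less.prems(1) by auto
    have crit: "vertex_critical E X" "vertex_critical E Y"
      using vertex_critical_joinL[of X Y] vertex_critical_joinL[of Y X] fin XY(1,2) less.prems(2)
      by (auto simp: joined_commute Un_commute)
    have "X \<subset> W" "Y \<subset> W" using XY unfolding joined_def by blast+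
    then have card: "card X < card W" "card Y < card W"
      using less.prems(1) psubset_card_mono by blast+
    obtain \<C> where C: "\<Union>\<C> = X" "pairwise (joined E) \<C>"
      "\<forall>C\<in>\<C>. join_irreducible E C \<and> vertex_critical E C"
      using less.hyps[OF card(1) fin(1) crit(1)] by blast
    obtain \<D> where D: "\<Union>\<D> = Y" "pairwise (joined E) \<D>"
      "\<forall>C\<in>\<D>. join_irreducible E C \<and> vertex_critical E C"
      using less.hyps[OF card(2) fin(2) crit(2)] by blast
    have cross: "joined E C D" "joined E D C" if "C \<in> \<C>" "D \<in> \<D>" for C D
    proof -
      have "C \<subseteq> X" "D \<subseteq> Y" using that C(1) D(1) by auto
      then show "joined E C D" using XY(2) unfolding joined_def by blast
      then show "joined E D C" by (simp add: joined_commute)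
    qed
    have "pairwise (joined E) (\<C> \<union> \<D>)"
    proof (rule pairwiseI)
      fix S T assume "S \<in> \<C> \<union> \<D>" "T \<in> \<C> \<union> \<D>" "S \<noteq> T"
      then show "joined E S T"
        using cross[of S T] cross[of T S] pairwiseD[OF C(2), of S T] pairwiseD[OF D(2), of S T] by blast
    qed
    moreover have "\<Union>(\<C> \<union> \<D>) = W" using C(1) D(1) XY(1) by auto
    ultimately show ?thesis using C(3) D(3) by (intro exI[of _ "\<C> \<union> \<D>"]) auto
  qed
qed

text \<open>Criticality frees a colour once \<open>c\<close> is deleted, and the nonadjacent
  vertices \<open>u\<close> and \<open>c\<close> can share it.\<close>

lemma chi_absorb:
  assumes "finite C" "vertex_critical E C" "c \<in> C" "{u, c} \<notin> E"
  shows "chi E (insert u C) \<le> chi E C"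
proof -
  have "colorable E {u, c} 1"
    using assms(4) no_loop by (auto simp: colorable_def insert_commute)
  then have "chi E {u, c} \<le> 1" by (rule chi_le)
  moreover have "chi E (C - {c}) < chi E C"
    using assms(2,3) unfolding vertex_critical_def by blast
  moreover have "insert u C = (C - {c}) \<union> {u, c}" using assms(3) by blast
  ultimately show ?thesis using chi_Un_le[of "C - {c}" "{u, c}"] assms(1) by simp
qed

text \<open>Injectivity of \<open>f\<close> means that each part absorbs at most one vertex; the
  enlarged parts then get separate palettes.\<close>

lemma chi_absorb_family:
  assumes "finite \<Z>" "\<And>C. C \<in> \<Z> \<Longrightarrow> finite C" "\<And>C. C \<in> \<Z> \<Longrightarrow> vertex_critical E C"
    and "finite U" "inj_on f U" "\<And>u. u \<in> U \<Longrightarrow> f u \<in> \<Z>" "\<And>u. u \<in> U \<Longrightarrow> \<exists>c\<in>f u. {u, c} \<notin> E"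
  shows "chi E (\<Union>\<Z> \<union> U) \<le> (\<Sum>C\<in>\<Z>. chi E C)"
proof -
  define F where "F C = C \<union> {u \<in> U. f u = C}" for C
  have le: "chi E (F C) \<le> chi E C" if C: "C \<in> \<Z>" for C
  proof (cases "\<exists>u\<in>U. f u = C")
    case True
    then obtain u where u: "u \<in> U" "f u = C" by blast
    then have "{w \<in> U. f w = C} = {u}" using assms(5) by (auto dest: inj_onD)
    then have F: "F C = insert u C" by (simp add: F_def)
    obtain c where "c \<in> C" "{u, c} \<notin> E" using u assms(7) by blast
    then show ?thesis unfolding F using C assms(2,3) by (intro chi_absorb) auto
  next
    case False
    then have "F C = C" by (auto simp: F_def)
    then show ?thesis by simp
  qed
  have "\<Union>\<Z> \<union> U = (\<Union>C\<in>\<Z>. F C)" using assms(6) by (auto simp: F_def)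
  moreover have "chi E (\<Union>C\<in>\<Z>. F C) \<le> (\<Sum>C\<in>\<Z>. chi E (F C))"
    using assms(1,2,4) by (intro chi_Union_le) (auto simp: F_def)
  moreover have "\<dots> \<le> (\<Sum>C\<in>\<Z>. chi E C)" by (intro sum_mono le)
  ultimately show ?thesis by simp
qed

text \<open>Remove a vertex, take a critical subgraph \<open>W0\<close> of chromatic number one less, and split it into
  its join components. A vertex of \<open>U = W - W0\<close> with a non-neighbour in a component can be absorbed by
  that component without a new colour, so Hall's theorem forces \<open>U\<close> to outnumber the components.\<close>

lemma gallai_critical_card:
  assumes "finite W" "vertex_critical E W" "join_irreducible E W"
  shows "2 * chi E W \<le> card W + 1"
  using assms
proof (induction "card W" arbitrary: W rule: less_induct)
  case less
  note fin = less.prems(1) and crit = less.prems(2) and irr = less.prems(3)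
  obtain v where v: "v \<in> W" using irr unfolding join_irreducible_def by blast
  have "chi E W \<le> chi E (W - {v}) + 1"
    using chi_insert_le[of "W - {v}" v] fin v by (simp add: insert_absorb)
  moreover have lt: "chi E (W - {v}) < chi E W" using crit v unfolding vertex_critical_def by blast
  ultimately have "chi E W - 1 \<le> chi E (W - {v})" by simp
  then obtain W0 where W0: "W0 \<subseteq> W - {v}" "vertex_critical E W0" "chi E W0 = chi E W - 1"
    using critical_subset[of "W - {v}"] fin by auto
  have finW0: "finite W0" using W0(1) fin finite_subset by blast
  obtain \<C> where C: "\<Union>\<C> = W0" "pairwise (joined E) \<C>"
    "\<forall>C\<in>\<C>. join_irreducible E C \<and> vertex_critical E C"
    using critical_join_decomposition[OF finW0 W0(2)] by blast
  have finC: "finite C" if "C \<in> \<C>" for C using that C(1) finW0 by (metis Sup_upper finite_subset)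
  have fin\<C>: "finite \<C>" using C(1) finW0 finite_UnionD by blast
  have neC: "C \<noteq> {}" if "C \<in> \<C>" for C using that C(3) unfolding join_irreducible_def by blast
  have sum: "(\<Sum>C\<in>\<D>. chi E C) = chi E (\<Union>\<D>)" if "\<D> \<subseteq> \<C>" for \<D>
    using that C(2) finC fin\<C>
    by (intro chi_Union_join[symmetric]) (auto intro: finite_subset pairwise_subset)
  define U where "U = W - W0"
  have finU: "finite U" and vU: "v \<in> U" using fin v W0(1) by (auto simp: U_def)
  define nb where "nb u = {C \<in> \<C>. \<exists>c\<in>C. {u, c} \<notin> E}" for u
  have finnb: "finite (nb u)" "nb u \<subseteq> \<C>" for u using fin\<C> by (auto simp: nb_def)
  \<comment> \<open>\<open>df\<close> is Hall's deficiency. A set \<open>T\<close> maximizing it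
    leaves Hall's condition valid for \<open>U - T\<close> with respect to the components outside
    \<open>\<N>\<close>, so these can absorb all of \<open>U - T\<close>.\<close>
  define df where "df T = int (card T) - int (card (\<Union>(nb ` T)))" for T
  have "finite (df ` Pow U)" "df ` Pow U \<noteq> {}" using finU by auto
  then obtain T where T: "T \<subseteq> U" "\<And>T'. T' \<subseteq> U \<Longrightarrow> df T' \<le> df T"
    by (metis (mono_tags, lifting) Max_ge Max_in PowD PowI imageE imageI)
  have finT: "finite T" using T(1) finU finite_subset by blast
  define \<N> where "\<N> = \<Union>(nb ` T)"
  define \<Z> where "\<Z> = \<C> - \<N>"
  have N_sub: "\<N> \<subseteq> \<C>" using finnb by (auto simp: \<N>_def)
  have finN: "finite \<N>" and finZ: "finite \<Z>" using N_sub fin\<C> finite_subset by (auto simp: \<Z>_def)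
  have "\<exists>f. inj_on f (U - T) \<and> (\<forall>u\<in>U - T. f u \<in> nb u - \<N>)"
  proof (rule hall_transversal)
    show "finite (U - T)" using finU by simp
    show "finite (nb u - \<N>)" for u using finnb by simp
    fix J assume J: "J \<subseteq> U - T"
    have finJ: "finite J" using J finU finite_subset by blast
    have "card (\<Union>(nb ` (T \<union> J))) = card \<N> + card (\<Union>((\<lambda>u. nb u - \<N>) ` J))"
    proof -
      have "\<Union>(nb ` (T \<union> J)) = \<N> \<union> \<Union>((\<lambda>u. nb u - \<N>) ` J)" by (auto simp: \<N>_def)
      moreover have "finite (\<Union>((\<lambda>u. nb u - \<N>) ` J))" using finJ finnb by auto
      moreover have "\<N> \<inter> \<Union>((\<lambda>u. nb u - \<N>) ` J) = {}" by auto
      ultimately show ?thesis using finN card_Un_disjoint by metis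
    qed
    moreover have "card (T \<union> J) = card T + card J"
      using J finT finJ by (intro card_Un_disjoint) auto
    moreover have "df (T \<union> J) \<le> df T" using J T(1) by (intro T(2)) auto
    ultimately show "card J \<le> card (\<Union>((\<lambda>u. nb u - \<N>) ` J))" by (simp add: df_def \<N>_def)
  qed
  then obtain f where f: "inj_on f (U - T)" "\<forall>u\<in>U - T. f u \<in> nb u - \<N>" by blast
  have absorbed: "chi E (\<Union>\<Z> \<union> (U - T)) \<le> (\<Sum>C\<in>\<Z>. chi E C)"
  proof -
    have "f u \<in> \<Z> \<and> (\<exists>c\<in>f u. {u, c} \<notin> E)" if "u \<in> U - T" for u
      using f(2) that by (auto simp: \<Z>_def nb_def)
    then show ?thesis
      using finZ finC C(3) finU f(1) by (intro chi_absorb_family[where f = f]) (auto simp: \<Z>_def)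
  qed
  define X where "X = T \<union> \<Union>\<N>"
  have finX: "finite X" "finite (\<Union>\<Z>)"
    using finT finN finZ finC N_sub by (auto simp: X_def \<Z>_def)
  have UW0: "U \<inter> W0 = {}" "U \<union> W0 = W" using W0(1) by (auto simp: U_def)
  have jNZ: "joined E N Z" if "N \<in> \<N>" "Z \<in> \<C>" "Z \<notin> \<N>" for N Z
    using that C(2) N_sub pairwiseD[of "joined E" \<C> N Z] by blast
  \<comment> \<open>A component outside \<open>\<N>\<close> contains no non-neighbour of a vertex of
    \<open>T\<close>, and it is joined to every other component.\<close>
  have j: "joined E X (\<Union>\<Z>)"
    unfolding joined_def
  proof (intro conjI ballI)
    show "X \<inter> \<Union>\<Z> = {}"
    proof (rule ccontr)
      assume "X \<inter> \<Union>\<Z> \<noteq> {}"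
      then obtain x Z where x: "x \<in> X" "x \<in> Z" "Z \<in> \<Z>" by blast
      then have "x \<notin> T" using UW0(1) T(1) C(1) by (auto simp: \<Z>_def)
      then obtain N where "N \<in> \<N>" "x \<in> N" using x by (auto simp: X_def)
      then show False using x jNZ[of N Z] by (auto simp: joined_def \<Z>_def)
    qed
    fix x y assume x: "x \<in> X" and "y \<in> \<Union>\<Z>"
    then obtain Z where Z: "Z \<in> \<C>" "Z \<notin> \<N>" "y \<in> Z" by (auto simp: \<Z>_def)
    show "{x, y} \<in> E"
    proof (cases "x \<in> T")
      case True
      then show ?thesis using Z by (auto simp: \<N>_def nb_def)
    next
      case False
      then obtain N where "N \<in> \<N>" "x \<in> N" using x by (auto simp: X_def)
      then show ?thesis using Z jNZ[of N Z] by (auto simp: joined_def)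
    qed
  qed
  have WX: "W = X \<union> (\<Union>\<Z> \<union> (U - T))"
    using UW0(2) C(1) T(1) N_sub by (auto simp: X_def \<Z>_def)
  have "chi E W \<le> chi E X + chi E (\<Union>\<Z> \<union> (U - T))"
    unfolding WX using finX finU by (intro chi_Un_le) auto
  also have "\<dots> \<le> chi E X + chi E (\<Union>\<Z>)"
    using absorbed sum[of \<Z>] by (auto simp: \<Z>_def)
  also have "\<dots> = chi E (X \<union> \<Union>\<Z>)" using finX j by (intro chi_join[symmetric]) auto
  finally have big: "chi E W \<le> chi E (X \<union> \<Union>\<Z>)" .
  \<comment> \<open>As \<open>U - T\<close> was absorbed without new colours, the join of
    \<open>X\<close> and \<open>\<Union>\<Z>\<close> already has the full chromatic number.
    Criticality leaves no vertex outside it, and irreducibility then empties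
    \<open>\<Z>\<close>.\<close>
  have full: "X \<union> \<Union>\<Z> = W"
  proof (rule ccontr)
    assume "X \<union> \<Union>\<Z> \<noteq> W"
    then obtain x where x: "x \<in> W" "x \<notin> X \<union> \<Union>\<Z>" using WX by blast
    then have "chi E (X \<union> \<Union>\<Z>) \<le> chi E (W - {x})"
      using WX fin by (intro chi_mono) auto
    also have "\<dots> < chi E W" using crit x(1) unfolding vertex_critical_def by blast
    finally show False using big by simp
  qed
  have "U - T = {}"
  proof -
    have "(U - T) \<inter> \<Union>\<C> = {}" using UW0(1) C(1) by blast
    then have "(U - T) \<inter> (X \<union> \<Union>\<Z>) = {}" using N_sub by (auto simp: X_def \<Z>_def)
    then show ?thesis using full UW0(2) by blast
  qed
  then have TU: "T = U" using T(1) by blast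
  have "\<Union>\<Z> = {}"
    using irr[unfolded join_irreducible_def] full[symmetric] j vU TU by (auto simp: X_def)
  then have "\<Z> = {}" using neC by (auto simp: \<Z>_def)
  then have NC: "\<N> = \<C>" using N_sub by (auto simp: \<Z>_def)
  \<comment> \<open>With at least as many components as vertices in \<open>U\<close>, the maximal
    deficiency would be at most 0, and the components of \<open>W0\<close> could absorb all of
    \<open>U\<close>, although \<open>W0\<close> needs fewer colours than \<open>W\<close>.\<close>
  have "card \<C> < card U"
  proof (rule ccontr)
    assume "\<not> ?thesis"
    then have "df T \<le> 0" using TU NC by (simp add: df_def \<N>_def)
    then have "df T' \<le> 0" if "T' \<subseteq> U" for T' using T(2)[OF that] by simp
    then have "\<exists>g. inj_on g U \<and> (\<forall>u\<in>U. g u \<in> nb u)"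
      using finU finnb(1) by (intro hall_transversal) (auto simp: df_def)
    then obtain g where g: "inj_on g U" "\<forall>u\<in>U. g u \<in> nb u" by blast
    have "chi E (\<Union>\<C> \<union> U) \<le> (\<Sum>C\<in>\<C>. chi E C)"
      using fin\<C> finC C(3) finU g by (intro chi_absorb_family[where f = g]) (auto simp: nb_def)
    then have "chi E W \<le> chi E W0" using sum[of \<C>] C(1) UW0(2) by (simp add: Un_commute)
    then show False using W0(3) lt by simp
  qed
  \<comment> \<open>Summing the induction hypothesis costs one unit per component;
    \<open>card \<C> < card U\<close> turns this into the single unit that the bound allows.\<close>
  moreover have "2 * chi E W0 \<le> card W0 + card \<C>"
  proof -
    have "2 * chi E C \<le> card C + 1" if "C \<in> \<C>" for C
    proof (rule less.hyps)
      have "C \<subset> W" using that C(1) W0(1) v by blast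
      then show "card C < card W" using fin by (rule psubset_card_mono[rotated])
    qed (use that finC C(3) in auto)
    then have "(\<Sum>C\<in>\<C>. 2 * chi E C) \<le> (\<Sum>C\<in>\<C>. card C + 1)" by (rule sum_mono)
    moreover have "card W0 = (\<Sum>C\<in>\<C>. card C)"
      using C(1,2) finC
      by (subst C(1)[symmetric], intro card_Union_disjoint)
        (auto simp: pairwise_def joined_def disjnt_def)
    ultimately show ?thesis
      using sum[of \<C>] C(1) by (simp add: sum_Suc flip: sum_distrib_left)
  qed
  moreover have "card W = card U + card W0"
    using card_Un_disjoint[OF finU finW0 UW0(1)] UW0(2) by simp
  ultimately show ?case using W0(3) lt by simp
qed

end

section \<open>Edge sets and degrees\<close>

definition edeg :: "'a set set \<Rightarrow> 'a \<Rightarrow> nat" where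
  "edeg E v = card {e \<in> E. v \<in> e}"

definition nbrs :: "'a set set \<Rightarrow> 'a \<Rightarrow> 'a set" where
  "nbrs E v = {w. {v, w} \<in> E}"

definition pairs_on :: "'a set \<Rightarrow> 'a set set" where
  "pairs_on V = {{u, v} |u v. u \<in> V \<and> v \<in> V \<and> u \<noteq> v}"

definition simple_on :: "'a set \<Rightarrow> 'a set set \<Rightarrow> bool" where
  "simple_on V E \<longleftrightarrow> finite V \<and> E \<subseteq> pairs_on V"

definition clique :: "'a set set \<Rightarrow> 'a set \<Rightarrow> bool" where
  "clique E A \<longleftrightarrow> pairs_on A \<subseteq> E"

lemma in_nbrs [simp]: "w \<in> nbrs E v \<longleftrightarrow> {v, w} \<in> E"
  by (simp add: nbrs_def)

lemma pair_in_pairs_on [simp]: "{u, v} \<in> pairs_on V \<longleftrightarrow> u \<in> V \<and> v \<in> V \<and> u \<noteq> v"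
  by (auto simp: pairs_on_def doubleton_eq_iff)

lemma singleton_notin_pairs_on [simp]: "{u} \<notin> pairs_on V"
  using pair_in_pairs_on[of u u V] by simp

lemma pairs_on_mono: "V \<subseteq> V' \<Longrightarrow> pairs_on V \<subseteq> pairs_on V'"
  by (auto simp: pairs_on_def)

lemma simple_onD:
  assumes "simple_on V E" "{u, v} \<in> E"
  shows "u \<in> V" "v \<in> V" "u \<noteq> v"
  using assms pair_in_pairs_on[of u v V] unfolding simple_on_def by blast+

lemma cliqueD: "clique E A \<Longrightarrow> u \<in> A \<Longrightarrow> v \<in> A \<Longrightarrow> u \<noteq> v \<Longrightarrow> {u, v} \<in> E"
  using pair_in_pairs_on[of u v A] unfolding clique_def by blast

lemma finite_pairs_on: "finite V \<Longrightarrow> finite (pairs_on V)"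
  by (rule finite_subset[of _ "Pow V"]) (auto simp: pairs_on_def)

lemma simple_on_finite: "simple_on V E \<Longrightarrow> finite E"
  unfolding simple_on_def using finite_pairs_on finite_subset by blast

lemma nbrs_subset: "simple_on V E \<Longrightarrow> nbrs E v \<subseteq> V - {v}"
  using simple_onD[of V E v v] by (auto dest: simple_onD)

lemma finite_nbrs: "simple_on V E \<Longrightarrow> finite (nbrs E v)"
  by (rule finite_subset[OF nbrs_subset]) (auto simp: simple_on_def)

lemma edeg_eq_card_nbrs:
  assumes "simple_on V E"
  shows "edeg E v = card (nbrs E v)"
proof -
  have "bij_betw (\<lambda>w. {v, w}) (nbrs E v) {e \<in> E. v \<in> e}"
  proof (rule bij_betw_imageI)
    show "inj_on (\<lambda>w. {v, w}) (nbrs E v)" by (auto simp: inj_on_def doubleton_eq_iff)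
    show "(\<lambda>w. {v, w}) ` nbrs E v = {e \<in> E. v \<in> e}"
    proof (intro set_eqI iffI)
      fix e assume e: "e \<in> {e \<in> E. v \<in> e}"
      then obtain a b where "e = {a, b}" using assms by (auto simp: simple_on_def pairs_on_def)
      then show "e \<in> (\<lambda>w. {v, w}) ` nbrs E v"
        using e by (auto simp: image_iff insert_commute doubleton_eq_iff)
    qed auto
  qed
  then show ?thesis unfolding edeg_def by (simp add: bij_betw_same_card)
qed

lemma edeg_empty [simp]: "edeg {} v = 0"
  by (simp add: edeg_def)

lemma edeg_insert:
  assumes "finite S"
  shows "edeg (insert e S) v = edeg S v + (if e \<notin> S \<and> v \<in> e then 1 else 0)"
proof -
  have "{f \<in> insert e S. v \<in> f} = (if v \<in> e then insert e {f \<in> S. v \<in> f} else {f \<in> S. v \<in> f})"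
    by auto
  then show ?thesis using assms unfolding edeg_def by (auto simp: card_insert_if)
qed

lemma edeg_union:
  assumes "finite S" "finite T" "S \<inter> T = {}"
  shows "edeg (S \<union> T) v = edeg S v + edeg T v"
proof -
  have "{f \<in> S \<union> T. v \<in> f} = {f \<in> S. v \<in> f} \<union> {f \<in> T. v \<in> f}" by auto
  then show ?thesis using assms unfolding edeg_def by (simp add: card_Un_disjoint disjoint_iff)
qed

text \<open>Sums on both sides keep the balance of an exchange free of truncated
  subtraction.\<close>

lemma edeg_exchange:
  assumes "finite H" "R \<subseteq> H" "finite S" "S \<inter> H = {}"
  shows "edeg ((H - R) \<union> S) v + edeg R v = edeg H v + edeg S v"
proof -
  have "edeg ((H - R) \<union> R) v = edeg (H - R) v + edeg R v"
    using assms finite_subset by (intro edeg_union) auto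
  moreover have "(H - R) \<union> R = H" using assms(2) by auto
  moreover have "edeg ((H - R) \<union> S) v = edeg (H - R) v + edeg S v"
    using assms by (intro edeg_union) auto
  ultimately show ?thesis by simp
qed

lemma sum_card_nbrs_swap:
  assumes "finite X" "finite Y"
  shows "(\<Sum>x\<in>X. card (nbrs E x \<inter> Y)) = (\<Sum>y\<in>Y. card (nbrs E y \<inter> X))"
proof -
  have "(\<Sum>x\<in>X. card (nbrs E x \<inter> Y)) = (\<Sum>x\<in>X. \<Sum>y\<in>Y. if {x, y} \<in> E then 1 else 0)"
    using assms by (intro sum.cong refl) (auto simp: sum.If_cases Int_def nbrs_def conj_commute)
  also have "\<dots> = (\<Sum>y\<in>Y. \<Sum>x\<in>X. if {y, x} \<in> E then 1 else 0)"
    by (subst sum.swap) (simp add: insert_commute)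
  also have "\<dots> = (\<Sum>y\<in>Y. card (nbrs E y \<inter> X))"
    using assms by (intro sum.cong refl) (auto simp: sum.If_cases Int_def nbrs_def conj_commute)
  finally show ?thesis .
qed

lemma even_sum_edeg:
  assumes "simple_on V E"
  shows "even (\<Sum>v\<in>V. edeg E v)"
proof -
  have fin: "finite V" "finite E" using assms simple_on_finite by (auto simp: simple_on_def)
  have "(\<Sum>v\<in>V. edeg E v) = (\<Sum>v\<in>V. \<Sum>e\<in>E. if v \<in> e then 1 else 0)"
    using fin by (intro sum.cong refl) (simp add: edeg_def sum.If_cases Int_def)
  also have "\<dots> = (\<Sum>e\<in>E. \<Sum>v\<in>V. if v \<in> e then 1 else 0)" by (rule sum.swap)
  also have "\<dots> = (\<Sum>e\<in>E. 2)"
  proof (intro sum.cong refl)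
    fix e assume "e \<in> E"
    then obtain a b where e: "e = {a, b}" "a \<in> V" "b \<in> V" "a \<noteq> b"
      using assms by (auto simp: simple_on_def pairs_on_def)
    then have "{v \<in> V. v \<in> e} = {a, b}" by auto
    then show "(\<Sum>v\<in>V. if v \<in> e then 1 else 0) = (2::nat)"
      using fin e by (simp add: sum.If_cases Int_def)
  qed
  finally show ?thesis by simp
qed

section \<open>Realizations containing a clique\<close>

text \<open>Applied with \<open>o'\<close> hubs, \<open>i = |IA|\<close>, \<open>j = |IB|\<close>,
  \<open>l = |L - IB|\<close>, \<open>m = |V - A|\<close>, and \<open>\<tau>\<close> the excess over
  k - 1 of the least degree in \<open>IA\<close>. The last hypothesis is linear in
  \<open>\<tau>\<close>, so it is refuted at the end of the range of \<open>\<tau>\<close> that the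
  sign of \<open>o' - i\<close> selects.\<close>

lemma stuck_arith:
  fixes o' i j l m \<tau> :: int
  assumes "1 \<le> o'" "1 \<le> i" "0 \<le> j" "0 \<le> l" "m = o' + j + l" "0 \<le> \<tau>" "\<tau> \<le> o' - 1"
    and "o' * (m - j - i) + i * \<tau> + j * (i - 1) + 1 \<le> o' * \<tau>"
  shows "m < i"
proof (rule ccontr)
  assume "\<not> m < i"
  then have im: "i \<le> m" by simp
  show False
  proof (cases "i \<le> o'")
    case True
    have "(o' - i) * \<tau> \<le> (o' - i) * (o' - 1)" using True assms by (intro mult_left_mono) auto
    moreover have "o' * (o' - i) \<le> o' * (m - j - i)" using assms by (intro mult_left_mono) auto
    moreover have "0 \<le> j * (i - 1)" using assms by simp
    ultimately show False using assms(8) True by (simp add: algebra_simps)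
  next
    case False
    have "(o' - i) * \<tau> \<le> 0" using False assms by (simp add: mult_nonpos_nonneg)
    moreover have "0 \<le> o' * (m - i)" using im assms by simp
    moreover have "0 \<le> j * (i - 1 - o')" using False assms by simp
    ultimately show False using assms(8) by (simp add: algebra_simps)
  qed
qed

text \<open>Vertices of \<open>V - A\<close> are saturated greedily by decreasing degree: \<open>F\<close> is the saturated part and
  \<open>s\<close> the next vertex, whose degree cannot be raised while \<open>A\<close> stays a clique and \<open>A \<union> F\<close> saturated.\<close>

locale stuck_subrealization =
  fixes V A F :: "'a set" and s :: 'a and d :: "'a \<Rightarrow> nat" and G H :: "'a set set"
  assumes G: "simple_on V G" "\<And>v. v \<in> V \<Longrightarrow> edeg G v = d v"
    and H: "simple_on V H" "\<And>v. v \<in> V \<Longrightarrow> edeg H v \<le> d v" "clique H A"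
    and sub: "A \<subseteq> V" "F \<subseteq> V - A" "s \<in> V - A - F"
    and full: "\<And>v. v \<in> A \<union> F \<Longrightarrow> edeg H v = d v"
    and top: "\<And>v. v \<in> A \<union> F \<Longrightarrow> d s \<le> d v" "\<And>a b. a \<in> A \<Longrightarrow> b \<in> F \<Longrightarrow> d b \<le> d a"
    and deficient: "edeg H s < d s"
    and max: "\<And>H'. \<lbrakk>simple_on V H'; \<And>v. v \<in> V \<Longrightarrow> edeg H' v \<le> d v; clique H' A;
        \<And>v. v \<in> A \<union> F \<Longrightarrow> edeg H' v = d v\<rbrakk> \<Longrightarrow> edeg H' s \<le> edeg H s"
begin

text \<open>Only non-adjacencies to \<open>hubs\<close> matter for the final count: exchanges show
  that vertices of \<open>IA\<close> and \<open>IB\<close> have no neighbour among the remaining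
  vertices \<open>L\<close>, and that those of \<open>IB\<close> are saturated.\<close>

definition "L = V - A - F - {s}"
definition "hubs = insert s F"
definition "IA = {a \<in> A. \<exists>x\<in>hubs. {a, x} \<notin> H}"
definition "IB = {z \<in> L. \<exists>x\<in>hubs. {z, x} \<notin> H}"

section \<open>Exchanges excluded by the maximality of H\<close>

lemma finV: "finite V" and finH: "finite H"
  using H(1) simple_on_finite by (auto simp: simple_on_def)

lemma V_cases:
  assumes "v \<in> V"
  obtains "v \<in> A" | "v \<in> F" | "v = s" | "v \<in> L"
  using assms by (auto simp: L_def)

lemma disj: "s \<notin> A" "s \<notin> F" "s \<notin> L" "s \<in> V" "v \<in> L \<Longrightarrow> v \<notin> A" "v \<in> L \<Longrightarrow> v \<notin> F"
  "v \<in> L \<Longrightarrow> v \<in> V" "v \<in> F \<Longrightarrow> v \<notin> A" "v \<in> F \<Longrightarrow> v \<in> V" "v \<in> A \<Longrightarrow> v \<in> V"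
  using sub by (auto simp: L_def)

text \<open>The common form of all exchanges: remove \<open>R\<close>, add \<open>S\<close>. As no
  removed edge lies inside \<open>A\<close>, the clique survives and \<open>max\<close> forbids a
  gain at \<open>s\<close>. Vertices of \<open>L\<close> may lose degree freely.\<close>

lemma no_exchange:
  assumes "R \<subseteq> H" "S \<subseteq> pairs_on V" "S \<inter> H = {}" "\<And>e. e \<in> R \<Longrightarrow> \<not> e \<subseteq> A"
    and "\<And>v. v \<in> A \<union> F \<Longrightarrow> edeg S v = edeg R v"
    and "\<And>v. v \<in> L \<Longrightarrow> edeg H v + edeg S v \<le> d v + edeg R v"
    and "edeg R s < edeg S s" "edeg H s + edeg S s \<le> d s + edeg R s"
  shows False
proof -
  let ?H = "(H - R) \<union> S"
  have finS: "finite S" using assms(2) finite_pairs_on[OF finV] finite_subset by blast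
  have ex: "edeg ?H v + edeg R v = edeg H v + edeg S v" for v
    using edeg_exchange[OF finH assms(1) finS assms(3)] .
  have "edeg ?H s \<le> edeg H s"
  proof (rule max)
    show "simple_on V ?H" using H(1) assms(2) by (auto simp: simple_on_def)
    show "edeg ?H v \<le> d v" if "v \<in> V" for v
      using that ex[of v] assms(5)[of v] assms(6)[of v] assms(8) full[of v] by (cases v rule: V_cases) auto
    have "e \<notin> R" if "e \<in> pairs_on A" for e
      using that assms(4)[of e] by (auto simp: pairs_on_def)
    then show "clique ?H A" using H(3) unfolding clique_def by blast
    show "edeg ?H v = d v" if "v \<in> A \<union> F" for v using that ex[of v] assms(5)[of v] full[of v] by simp
  qed
  then show False using ex[of s] assms(7) by simp
qed

text \<open>One missing edge at \<open>s\<close> leaves room for any net gain of one; likewise a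
  deficient vertex of \<open>L\<close> may receive one edge.\<close>

lemma gain_one:
  assumes "R \<subseteq> H" "S \<subseteq> pairs_on V" "S \<inter> H = {}" "\<And>e. e \<in> R \<Longrightarrow> \<not> e \<subseteq> A"
    and "\<And>v. v \<in> A \<union> F \<Longrightarrow> edeg S v = edeg R v"
    and "\<And>v. v \<in> L \<Longrightarrow> edeg S v \<le> edeg R v \<or> edeg S v \<le> edeg R v + 1 \<and> edeg H v < d v"
    and "edeg S s = 1" "edeg R s = 0"
  shows False
proof -
  have "edeg H v + edeg S v \<le> d v + edeg R v" if "v \<in> L" for v
    using assms(6)[OF that] H(2)[of v] that by (auto simp: L_def)
  then show False using no_exchange[OF assms(1-5)] assms(7,8) deficient by simp
qed

text \<open>Otherwise the edge \<open>sz\<close> could be added outright.\<close>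

lemma nonadj_deficient:
  assumes "z \<in> L" "{s, z} \<notin> H"
  shows "edeg H z = d z"
proof (rule ccontr)
  assume "edeg H z \<noteq> d z"
  then have "edeg H z < d z" using H(2)[of z] assms(1) disj by (simp add: le_neq_implies_less)
  then show False
    using assms disj
    by (intro gain_one[of "{}" "{{s, z}}"]) (auto simp: edeg_insert)
qed

text \<open>If \<open>s\<close> lacks only one edge, parity yields another deficient vertex, necessarily adjacent to
  \<open>s\<close>; deleting that edge makes room for two new edges at \<open>s\<close>.\<close>

lemma gain_two:
  assumes "R \<subseteq> H" "S \<subseteq> pairs_on V" "S \<inter> H = {}" "\<And>e. e \<in> R \<Longrightarrow> \<not> e \<subseteq> A"
    and "\<And>v. v \<in> A \<union> F \<Longrightarrow> edeg S v = edeg R v"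
    and "\<And>v. v \<in> L \<Longrightarrow> edeg S v \<le> edeg R v"
    and "edeg S s = 2" "edeg R s = 0"
  shows False
proof -
  have L: "edeg H v + edeg S v \<le> d v + edeg R v" if "v \<in> L" for v
    using that assms(6)[of v] H(2)[of v] disj by fastforce
  show False
  proof (cases "edeg H s + 2 \<le> d s")
    case True
    then show ?thesis using no_exchange[OF assms(1-5) L] assms(7,8) by simp
  next
    case False
    then have ds: "d s = edeg H s + 1" using deficient by simp
    have "\<exists>t\<in>L. edeg H t < d t"
    proof (rule ccontr)
      assume "\<not> ?thesis"
      then have "edeg H v = d v" if "v \<in> V - {s}" for v
        using that full[of v] H(2)[of v] by (cases "v \<in> L") (auto simp: L_def not_less intro: antisym)
      then have "(\<Sum>v\<in>V - {s}. edeg H v) = (\<Sum>v\<in>V - {s}. d v)" by (rule sum.cong[OF refl])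
      then have "(\<Sum>v\<in>V. d v) = (\<Sum>v\<in>V. edeg H v) + 1"
        using ds disj finV by (simp add: sum.remove[of V s])
      moreover have "(\<Sum>v\<in>V. d v) = (\<Sum>v\<in>V. edeg G v)" using G(2) by simp
      ultimately show False using even_sum_edeg[OF G(1)] even_sum_edeg[OF H(1)] by simp
    qed
    then obtain t where t: "t \<in> L" "edeg H t < d t" by blast
    have st: "{s, t} \<in> H" using nonadj_deficient[OF t(1)] t(2) by auto
    have finR: "finite R" using assms(1) finH finite_subset by blast
    have "{s, t} \<notin> R"
    proof
      assume "{s, t} \<in> R"
      then have "card {e \<in> R. s \<in> e} \<noteq> 0" using finR by (subst card_0_eq) auto
      then show False using assms(8) by (simp add: edeg_def)
    qed
    then have R': "edeg (insert {s, t} R) v = edeg R v + (if v \<in> {s, t} then 1 else 0)" for v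
      using finR by (simp add: edeg_insert)
    show ?thesis
    proof (rule no_exchange[of "insert {s, t} R" S])
      show "edeg S v = edeg (insert {s, t} R) v" if "v \<in> A \<union> F" for v
        using that assms(5)[of v] R'[of v] t(1) disj by auto
      show "edeg H v + edeg S v \<le> d v + edeg (insert {s, t} R) v" if "v \<in> L" for v
        using L[OF that] R'[of v] by simp
    qed (use assms st R'[of s] deficient disj in auto)
  qed
qed

text \<open>\<open>x\<close> has larger degree in \<open>H\<close> than \<open>s\<close>, and
  \<open>s\<close> has the two neighbours \<open>x\<close> and \<open>y\<close> that are not
  neighbours of \<open>x\<close>. Hence at least two neighbours of \<open>x\<close> other than
  \<open>s\<close> are not adjacent to \<open>s\<close>, and one of them avoids the prescribed
  \<open>q\<close>.\<close>

lemma private_nbrs: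
  assumes "x \<in> A \<union> F" "{s, x} \<in> H" "y \<noteq> x" "{s, y} \<in> H" "{x, y} \<notin> H"
  shows "\<exists>w. w \<noteq> q \<and> {x, w} \<in> H \<and> {s, w} \<notin> H \<and> w \<noteq> s"
proof (rule ccontr)
  assume "\<not> ?thesis"
  then have "nbrs H x \<subseteq> insert q (insert s (nbrs H x \<inter> nbrs H s))" by (auto simp: insert_commute)
  then have "card (nbrs H x) \<le> card (insert q (insert s (nbrs H x \<inter> nbrs H s)))"
    using finite_nbrs[OF H(1)] by (intro card_mono) auto
  also have "\<dots> \<le> card (nbrs H x \<inter> nbrs H s) + 2"
    using finite_nbrs[OF H(1)] by (simp add: card_insert_if)
  also have "\<dots> = card (insert x (insert y (nbrs H x \<inter> nbrs H s)))"
    using assms finite_nbrs[OF H(1)] simple_onD[OF H(1), of x x] by (subst card_insert_disjoint, auto)+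
  also have "\<dots> \<le> card (nbrs H s)"
    using assms finite_nbrs[OF H(1)] by (intro card_mono) auto
  finally show False
    using full[OF assms(1)] top(1)[OF assms(1)] deficient by (simp add: edeg_eq_card_nbrs[OF H(1)])
qed

text \<open>A vertex \<open>x\<close> of \<open>F\<close> not adjacent to \<open>s\<close> would
  have a neighbour \<open>w\<close> that \<open>s\<close> lacks; trading \<open>xw\<close> for
  \<open>sx\<close> and \<open>sw\<close> gains two edges at \<open>s\<close> and changes no other
  degree.\<close>

lemma F_adj_s:
  assumes "x \<in> F"
  shows "{s, x} \<in> H"
proof (rule ccontr)
  assume nadj: "{s, x} \<notin> H"
  have "\<not> nbrs H x \<subseteq> nbrs H s"
  proof
    assume "nbrs H x \<subseteq> nbrs H s"
    then have "edeg H x \<le> edeg H s"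
      using finite_nbrs[OF H(1)] by (simp add: edeg_eq_card_nbrs[OF H(1)] card_mono)
    then show False using full[of x] top(1)[of x] deficient assms by simp
  qed
  then obtain w where "w \<in> nbrs H x" "w \<notin> nbrs H s" by blast
  then have w: "{x, w} \<in> H" "{s, w} \<notin> H" by simp_all
  have d: "w \<noteq> x" "w \<noteq> s" "x \<noteq> s" "w \<in> V" "x \<in> V"
    using w nadj simple_onD[OF H(1) w(1)] assms disj by (auto simp: insert_commute)
  show False
    using w d nadj assms disj
    by (intro gain_two[of "{{x, w}}" "{{s, x}, {s, w}}"]) (auto simp: edeg_insert doubleton_eq_iff)
qed

text \<open>Trade \<open>aq\<close> for \<open>sa\<close>: apart from the gain at \<open>s\<close>,
  only \<open>q\<close> changes, and a vertex of \<open>L\<close> may lose an edge.\<close>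

lemma A_nonadj_s:
  assumes "a \<in> A" "{s, a} \<notin> H" "q \<in> L"
  shows "{a, q} \<notin> H"
proof
  assume aq: "{a, q} \<in> H"
  show False
    using assms disj aq H(2)[of q] simple_onD[OF H(1) aq]
    by (intro gain_one[of "{{a, q}}" "{{s, a}}"]) (auto simp: edeg_insert doubleton_eq_iff)
qed

lemma L_nonadj_s:
  assumes "z \<in> L" "{s, z} \<notin> H" "q \<in> L"
  shows "{z, q} \<notin> H"
proof
  assume aq: "{z, q} \<in> H"
  show False
    using assms disj aq H(2) simple_onD[OF H(1) aq]
    by (intro gain_one[of "{{z, q}}" "{{s, z}}"]) (auto simp: edeg_insert doubleton_eq_iff)
qed

text \<open>Trading \<open>xw\<close> for \<open>xy\<close> and \<open>sw\<close> raises the degrees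
  of \<open>s\<close> and \<open>y\<close> only. The surplus at \<open>y\<close> is harmless if
  \<open>y\<close> is a deficient vertex of \<open>L\<close>; otherwise \<open>y\<close> gives up an
  edge to some \<open>q\<close>, where either \<open>q\<close> lies in \<open>L\<close> or the loss
  is made good by a further edge \<open>sq\<close>. These are the three lemmas of this block. The
  last clause of \<open>priv\<close> keeps \<open>xw\<close> out of the clique on
  \<open>A\<close>.\<close>

context
  fixes x y
  assumes x: "x \<in> A \<union> F" and xy: "{x, y} \<notin> H" "x \<noteq> y" "{s, y} \<in> H" "y \<in> V" "y \<noteq> s"
    and priv: "\<And>q. \<exists>w. w \<noteq> q \<and> {x, w} \<in> H \<and> {s, w} \<notin> H \<and> w \<noteq> s \<and> \<not> (x \<in> A \<and> w \<in> A)"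
begin

lemma shift_full:
  assumes "y \<in> L"
  shows "edeg H y = d y"
proof (rule ccontr)
  assume "edeg H y \<noteq> d y"
  then have lt: "edeg H y < d y" using H(2)[of y] xy(4) by (simp add: le_neq_implies_less)
  obtain w where w: "{x, w} \<in> H" "{s, w} \<notin> H" "w \<noteq> s" "\<not> (x \<in> A \<and> w \<in> A)" using priv by blast
  have d: "w \<noteq> y" "w \<noteq> x" "w \<in> V" "x \<in> V" "x \<noteq> s"
    using w xy simple_onD[OF H(1) w(1)] x disj by auto
  show False
    using w d xy x lt assms disj H(2)
    by (intro gain_one[of "{{x, w}}" "{{x, y}, {s, w}}"]) (auto simp: edeg_insert doubleton_eq_iff)
qed

lemma shift_nonadj_L:
  assumes "y \<in> L \<or> y \<in> A" "q \<in> L"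
  shows "{y, q} \<notin> H"
proof
  assume yq: "{y, q} \<in> H"
  obtain w where w: "w \<noteq> q" "{x, w} \<in> H" "{s, w} \<notin> H" "w \<noteq> s" "\<not> (x \<in> A \<and> w \<in> A)"
    using priv by blast
  have d: "w \<noteq> y" "w \<noteq> x" "w \<in> V" "x \<in> V" "x \<noteq> s" "q \<noteq> x" "q \<noteq> y" "q \<noteq> s"
    using w xy yq simple_onD[OF H(1) w(2)] simple_onD[OF H(1) yq] x disj assms by auto
  show False
    using w d xy x yq assms disj H(2)
    by (intro gain_one[of "{{x, w}, {y, q}}" "{{x, y}, {s, w}}"])
      (auto simp: edeg_insert doubleton_eq_iff)
qed

lemma shift_nbr_adj_s:
  assumes "y \<in> F" "{y, q} \<in> H" "q \<noteq> s"
  shows "{s, q} \<in> H"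
proof (rule ccontr)
  assume sq: "{s, q} \<notin> H"
  obtain w where w: "w \<noteq> q" "{x, w} \<in> H" "{s, w} \<notin> H" "w \<noteq> s" "\<not> (x \<in> A \<and> w \<in> A)"
    using priv by blast
  have d: "w \<noteq> y" "w \<noteq> x" "w \<in> V" "x \<in> V" "x \<noteq> s" "q \<noteq> x" "q \<noteq> y" "q \<in> V"
    using w xy assms simple_onD[OF H(1) w(2)] simple_onD[OF H(1) assms(2)] x disj
    by (auto simp: insert_commute)
  show False
    using w d xy x assms disj sq
    by (intro gain_two[of "{{x, w}, {y, q}}" "{{x, y}, {s, w}, {s, q}}"])
      (auto simp: edeg_insert doubleton_eq_iff)
qed

end

lemma private_nbrs_F:
  assumes "x \<in> F" "y \<noteq> x" "{s, y} \<in> H" "{x, y} \<notin> H"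
  shows "\<exists>w. w \<noteq> q \<and> {x, w} \<in> H \<and> {s, w} \<notin> H \<and> w \<noteq> s \<and> \<not> (x \<in> A \<and> w \<in> A)"
  using private_nbrs[of x y q] assms F_adj_s[OF assms(1)] disj(8)[OF assms(1)] by auto

text \<open>If \<open>x\<close>, \<open>y\<close> in \<open>F\<close> were not adjacent,
  \<open>y\<close> would have a neighbour \<open>q\<close> that \<open>s\<close> lacks, contrary to
  \<open>shift_nbr_adj_s\<close>.\<close>

lemma hubs_clique:
  assumes "x \<in> hubs" "y \<in> hubs" "x \<noteq> y"
  shows "{x, y} \<in> H"
proof (rule ccontr)
  assume nadj: "{x, y} \<notin> H"
  have xy: "x \<in> F" "y \<in> F"
    using assms nadj F_adj_s[of x] F_adj_s[of y] by (auto simp: hubs_def insert_commute)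
  have adj: "{s, x} \<in> H" "{s, y} \<in> H" using F_adj_s xy by auto
  obtain q where q: "{y, q} \<in> H" "{s, q} \<notin> H" "q \<noteq> s"
    using private_nbrs[of y x] xy adj nadj assms(3) by (auto simp: insert_commute)
  have "{s, q} \<in> H"
    using xy nadj assms(3) adj(2) disj(2) disj(9)[OF xy(2)] q
    by (intro shift_nbr_adj_s[of x y q] private_nbrs_F[of x y]) auto
  then show False using q(2) by simp
qed

text \<open>If \<open>a\<close> misses \<open>s\<close> itself, \<open>sa\<close> can replace
  \<open>aq\<close>. Otherwise \<open>a\<close> misses some \<open>x\<close> in \<open>F\<close>,
  and the shift through \<open>x\<close> raises \<open>a\<close>, which could give up
  \<open>aq\<close>.\<close>

lemma IA_nbrs:
  assumes "a \<in> IA" "q \<in> L"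
  shows "{a, q} \<notin> H"
proof -
  obtain x where x: "a \<in> A" "x \<in> hubs" "{a, x} \<notin> H" using assms(1) by (auto simp: IA_def)
  show ?thesis
  proof (cases "{s, a} \<in> H")
    case True
    then have xF: "x \<in> F" using x by (auto simp: hubs_def insert_commute)
    have "a \<noteq> x" "{x, a} \<notin> H" using x xF disj(8) by (auto simp: insert_commute)
    then show ?thesis
      using x xF True assms(2) disj(1,10)
      by (intro shift_nonadj_L[of x a q] private_nbrs_F[of x a]) auto
  qed (use A_nonadj_s x assms(2) in auto)
qed

lemma IB_full:
  assumes "z \<in> IB"
  shows "edeg H z = d z" "q \<in> L \<Longrightarrow> {z, q} \<notin> H"
proof -
  obtain x where x: "z \<in> L" "x \<in> hubs" "{z, x} \<notin> H" using assms(1) by (auto simp: IB_def)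
  have "edeg H z = d z \<and> (\<forall>q\<in>L. {z, q} \<notin> H)"
  proof (cases "{s, z} \<in> H")
    case True
    then have xF: "x \<in> F" using x by (auto simp: hubs_def insert_commute)
    have "edeg H z = d z"
      using x True xF disj(3,6,7)
      by (intro shift_full[of x z] private_nbrs_F[of x z]) (auto simp: insert_commute)
    moreover have "{z, q} \<notin> H" if "q \<in> L" for q
      using x True xF disj(3,6,7) that
      by (intro shift_nonadj_L[of x z q] private_nbrs_F[of x z]) (auto simp: insert_commute)
    ultimately show ?thesis by blast
  qed (use nonadj_deficient L_nonadj_s x in auto)
  then show "edeg H z = d z" "q \<in> L \<Longrightarrow> {z, q} \<notin> H" by auto
qed

section \<open>Counting edges in the stuck configuration\<close>

lemma finites: "finite A" "finite F" "finite L" "finite hubs" "finite IA" "finite IB"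
  using finV sub by (auto simp: L_def hubs_def IA_def IB_def intro: finite_subset)

text \<open>When every hub is adjacent to all of \<open>A\<close>, the structure violates the Erdos-Gallai inequality
  for the vertex set \<open>A \<union> hubs\<close>.\<close>

lemma IA_nonempty: "IA \<noteq> {}"
proof
  assume "IA = {}"
  then have Ah: "{a, x} \<in> H" if "a \<in> A" "x \<in> hubs" for a x using that by (auto simp: IA_def)
  define Q where "Q = A \<union> hubs"
  have finQ: "finite Q" using finites by (simp add: Q_def)
  have V: "V = Q \<union> L" "Q \<inter> L = {}" using sub by (auto simp: Q_def hubs_def L_def)
  have Qcl: "{x, y} \<in> H" if "x \<in> Q" "y \<in> Q" "x \<noteq> y" for x y
    using that Ah[of x y] Ah[of y x] hubs_clique[of x y] cliqueD[OF H(3), of x y]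
    by (auto simp: Q_def insert_commute)
  \<comment> \<open>In either case \<open>y\<close> sends as many edges to \<open>Q\<close> in
    \<open>H\<close> as it can in any graph with degrees \<open>d\<close>: all \<open>|Q|\<close> of
    them, or \<open>d y\<close>.\<close>
  have dich: "Q \<subseteq> nbrs H y \<or> edeg H y = d y \<and> nbrs H y \<subseteq> Q" if y: "y \<in> L" for y
  proof (cases "Q \<subseteq> nbrs H y")
    case False
    then obtain x where "x \<in> Q" "x \<notin> nbrs H y" by blast
    then have x: "x \<in> Q" "{y, x} \<notin> H" by simp_all
    have "edeg H y = d y \<and> (\<forall>q\<in>L. {y, q} \<notin> H)"
    proof (cases "y \<in> IB")
      case False
      then have h: "{y, z} \<in> H" if "z \<in> hubs" for z using that y by (auto simp: IB_def)
      then have xA: "x \<in> A" using x by (auto simp: Q_def)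
      have sy: "{s, y} \<in> H" using h[of s] by (auto simp: hubs_def insert_commute)
      have sA: "{s, a} \<in> H" if "a \<in> A" for a
        using Ah[OF that, of s] by (auto simp: hubs_def insert_commute)
      have ne: "x \<noteq> y" "{x, y} \<notin> H" "y \<in> V" "y \<noteq> s" "x \<in> A \<union> F" "{s, x} \<in> H" "y \<noteq> x"
        using x xA y disj sA[OF xA] by (auto simp: insert_commute)
      \<comment> \<open>Since \<open>s\<close> is adjacent to all of \<open>A\<close>, any neighbour
        of \<open>x\<close> that \<open>s\<close> lacks lies outside \<open>A\<close>.\<close>
      have priv: "\<exists>w. w \<noteq> q \<and> {x, w} \<in> H \<and> {s, w} \<notin> H \<and> w \<noteq> s \<and> \<not> (x \<in> A \<and> w \<in> A)" for q
        using private_nbrs[OF ne(5,6,7) sy ne(2), of q] sA by blast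
      show ?thesis
        using shift_full[OF ne(5,2,1) sy ne(3,4) priv y]
          shift_nonadj_L[OF ne(5,2,1) sy ne(3,4) priv] y by blast
    qed (use IB_full in auto)
    moreover have "nbrs H y \<subseteq> V" using nbrs_subset[OF H(1)] by blast
    ultimately show ?thesis using V by auto
  qed blast
  have deg_split: "edeg K x = card (nbrs K x \<inter> Q) + card (nbrs K x \<inter> L)"
    if "simple_on V K" "x \<in> Q" for K x
  proof -
    have "nbrs K x = (nbrs K x \<inter> Q) \<union> (nbrs K x \<inter> L)" using nbrs_subset[OF that(1)] V by blast
    moreover have "card ((nbrs K x \<inter> Q) \<union> (nbrs K x \<inter> L)) = card (nbrs K x \<inter> Q) + card (nbrs K x \<inter> L)"
      using V(2) finQ finites by (intro card_Un_disjoint) auto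
    ultimately show ?thesis using edeg_eq_card_nbrs[OF that(1)] by simp
  qed
  have sum_split: "(\<Sum>x\<in>Q. edeg K x) = (\<Sum>x\<in>Q. card (nbrs K x \<inter> Q)) + (\<Sum>y\<in>L. card (nbrs K y \<inter> Q))"
    if "simple_on V K" for K
    using deg_split[OF that] sum_card_nbrs_swap[OF finQ finites(3)] by (simp add: sum.distrib)
  have "card (nbrs G x \<inter> Q) \<le> card (nbrs H x \<inter> Q)" if "x \<in> Q" for x
    using that Qcl[of x] finQ simple_onD(3)[OF G(1), of x] by (intro card_mono) auto
  then have "(\<Sum>x\<in>Q. card (nbrs G x \<inter> Q)) \<le> (\<Sum>x\<in>Q. card (nbrs H x \<inter> Q))" by (rule sum_mono)
  moreover have "card (nbrs G y \<inter> Q) \<le> card (nbrs H y \<inter> Q)" if y: "y \<in> L" for y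
    using dich[OF y]
  proof
    assume "Q \<subseteq> nbrs H y"
    then show ?thesis using finQ by (intro card_mono) auto
  next
    assume *: "edeg H y = d y \<and> nbrs H y \<subseteq> Q"
    have "card (nbrs G y \<inter> Q) \<le> card (nbrs G y)"
      using finite_nbrs[OF G(1)] by (intro card_mono) auto
    also have "\<dots> = card (nbrs H y)"
      using * G(2)[of y] y disj by (simp flip: edeg_eq_card_nbrs[OF G(1)] edeg_eq_card_nbrs[OF H(1)])
    also have "nbrs H y = nbrs H y \<inter> Q" using * by blast
    finally show ?thesis .
  qed
  then have "(\<Sum>y\<in>L. card (nbrs G y \<inter> Q)) \<le> (\<Sum>y\<in>L. card (nbrs H y \<inter> Q))" by (rule sum_mono)
  ultimately have "(\<Sum>x\<in>Q. edeg G x) \<le> (\<Sum>x\<in>Q. edeg H x)"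
    using sum_split[OF G(1)] sum_split[OF H(1)] by simp
  moreover have "(\<Sum>x\<in>Q. edeg H x) < (\<Sum>x\<in>Q. edeg G x)"
  proof (rule sum_strict_mono_ex1[OF finQ])
    show "\<forall>x\<in>Q. edeg H x \<le> edeg G x"
    proof
      fix x assume "x \<in> Q"
      then have "x \<in> V" using V(1) by blast
      then show "edeg H x \<le> edeg G x" using H(2) G(2) by simp
    qed
    show "\<exists>x\<in>Q. edeg H x < edeg G x" using deficient G(2)[of s] disj by (auto simp: Q_def hubs_def)
  qed
  ultimately show False by simp
qed

text \<open>A hub is adjacent to every other vertex outside \<open>IA \<union> IB\<close>, so its
  degree is determined by its edges to these two sets, which are counted from their other ends. The
  outcome \<open>|IA| > |V - A|\<close> together with
  \<open>|IA| \<le> |A| \<le> |V - A| + 1\<close> leaves only \<open>IA = A\<close> and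
  \<open>|A| = |V - A| + 1\<close>. The second conclusion is the room for turning
  \<open>V - A\<close> into a clique.\<close>

lemma stuck_structure:
  assumes mind: "\<And>v. v \<in> V \<Longrightarrow> card A \<le> d v + 1" and n: "2 * card A \<le> card V + 1"
  shows "card V + 1 = 2 * card A" "b \<in> V - A \<Longrightarrow> card (nbrs H b \<inter> A) + card A \<le> d b + 2"
proof -
  define k i j h l where "k = card A" and "i = card IA" and "j = card IB" and "h = card hubs"
    and "l = card (L - IB)"
  have IAsub: "IA \<subseteq> A" and IBsub: "IB \<subseteq> L" by (auto simp: IA_def IB_def)
  have hL: "hubs \<inter> A = {}" "hubs \<inter> L = {}" "L \<inter> A = {}" "hubs \<subseteq> V" "hubs \<union> L = V - A"
    using sub by (auto simp: hubs_def L_def)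
  have h1: "1 \<le> h" using finites by (auto simp: h_def hubs_def Suc_le_eq card_gt_0_iff)
  have i1: "1 \<le> i" using IA_nonempty finites by (auto simp: i_def Suc_le_eq card_gt_0_iff)
  have ik: "i \<le> k" using IAsub finites by (auto simp: i_def k_def card_mono)
  have cL: "card L = j + l"
    using IBsub finites card_Diff_subset[of IB L] card_mono[of L IB] by (auto simp: j_def l_def)
  have cB: "card (V - A) = h + j + l"
    using hL(2,5) finites cL card_Un_disjoint[of hubs L] by (simp add: h_def)
  have cV: "card V = k + h + j + l"
    using cB sub(1) finV card_mono[of V A] by (simp add: card_Diff_subset finites k_def)
  have cAI: "card (A - IA) = k - i" using IAsub finites by (simp add: card_Diff_subset k_def i_def)
  have nV: "nbrs H x \<subseteq> V - {x}" for x using nbrs_subset[OF H(1)] .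
  have deg_hub: "edeg H x = (h - 1) + l + (k - i) + card (nbrs H x \<inter> IA) + card (nbrs H x \<inter> IB)"
    if x: "x \<in> hubs" for x
  proof -
    have "nbrs H x = (hubs - {x}) \<union> ((L - IB) \<union> ((A - IA) \<union> ((nbrs H x \<inter> IA) \<union> (nbrs H x \<inter> IB))))"
    proof (intro equalityI subsetI)
      fix y assume y: "y \<in> nbrs H x"
      then have "y \<in> V" "y \<noteq> x" using nV by blast+
      then show "y \<in> (hubs - {x}) \<union> ((L - IB) \<union> ((A - IA) \<union> ((nbrs H x \<inter> IA) \<union> (nbrs H x \<inter> IB))))"
        using y hL(5) by blast
    next
      fix y assume "y \<in> (hubs - {x}) \<union> ((L - IB) \<union> ((A - IA) \<union> ((nbrs H x \<inter> IA) \<union> (nbrs H x \<inter> IB))))"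
      then show "y \<in> nbrs H x"
        using hubs_clique[OF x, of y] x by (auto simp: IA_def IB_def insert_commute)
    qed
    moreover have "card ((hubs - {x}) \<union> ((L - IB) \<union> ((A - IA) \<union> ((nbrs H x \<inter> IA) \<union> (nbrs H x \<inter> IB)))))
      = card (hubs - {x}) + (card (L - IB) + (card (A - IA) + (card (nbrs H x \<inter> IA) + card (nbrs H x \<inter> IB))))"
      using finites hL IAsub IBsub
      by (subst card_Un_disjoint, simp, simp, blast)+ simp
    ultimately show ?thesis
      using x finites cAI by (simp add: edeg_eq_card_nbrs[OF H(1)] h_def l_def)
  qed
  have deg_IA: "d a + 1 = k + card (nbrs H a \<inter> hubs)" if a: "a \<in> IA" for a
  proof -
    have aA: "a \<in> A" using a IAsub by blast
    have "nbrs H a = (A - {a}) \<union> (nbrs H a \<inter> hubs)"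
    proof (intro equalityI subsetI)
      fix y assume y: "y \<in> nbrs H a"
      then have "y \<in> V" "y \<noteq> a" "y \<notin> L" using simple_onD(2,3)[OF H(1), of a y] IA_nbrs[OF a, of y] by auto
      then show "y \<in> (A - {a}) \<union> (nbrs H a \<inter> hubs)" using y hL(5) by blast
    qed (use cliqueD[OF H(3) aA] in auto)
    then have "card (nbrs H a) = card (A - {a}) + card (nbrs H a \<inter> hubs)"
      using finites hL(1) card_Un_disjoint[of "A - {a}" "nbrs H a \<inter> hubs"] by auto
    moreover have "0 < card A" using aA finites card_gt_0_iff by blast
    ultimately show ?thesis
      using aA full[of a] finites by (simp add: edeg_eq_card_nbrs[OF H(1)] k_def)
  qed
  have nbr_IB: "nbrs H z \<subseteq> (A - IA) \<union> (nbrs H z \<inter> hubs)" if z: "z \<in> IB" for z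
  proof
    fix y assume y: "y \<in> nbrs H z"
    then have "y \<in> V" "y \<notin> L" using simple_onD(2)[OF H(1), of z y] IB_full(2)[OF z, of y] by auto
    moreover have "y \<notin> IA" using y IA_nbrs[of y z] z IBsub by (auto simp: insert_commute)
    ultimately show "y \<in> (A - IA) \<union> (nbrs H z \<inter> hubs)" using y hL(5) by blast
  qed
  have deg_IB: "d z \<le> (k - i) + card (nbrs H z \<inter> hubs)" if z: "z \<in> IB" for z
  proof -
    have "card (nbrs H z) \<le> card ((A - IA) \<union> (nbrs H z \<inter> hubs))"
      using nbr_IB[OF z] finites by (intro card_mono) auto
    also have "\<dots> \<le> card (A - IA) + card (nbrs H z \<inter> hubs)" by (rule card_Un_le)
    finally show ?thesis using IB_full(1)[OF z] cAI by (simp add: edeg_eq_card_nbrs[OF H(1)])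
  qed
  obtain a0 where a0: "a0 \<in> IA" "\<And>a. a \<in> IA \<Longrightarrow> d a0 \<le> d a"
    using IA_nonempty ex_has_least_nat[of "\<lambda>a. a \<in> IA" _ d] by blast
  have a0A: "a0 \<in> A" using a0 IAsub by blast
  \<comment> \<open>Besides its k - 1 neighbours in \<open>A\<close>, a vertex of \<open>IA\<close>
    has only hubs as neighbours, and it misses at least one hub.\<close>
  have t_hi: "d a0 + 2 \<le> k + h"
  proof -
    have "nbrs H a0 \<inter> hubs \<subset> hubs" using a0(1) by (auto simp: IA_def)
    then have "card (nbrs H a0 \<inter> hubs) < h" unfolding h_def using finites by (intro psubset_card_mono) auto
    then show ?thesis using deg_IA[OF a0(1)] by simp
  qed
  have t_lo: "k \<le> d a0 + 1" using deg_IA[OF a0(1)] by simp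
  have "(\<Sum>x\<in>hubs. edeg H x) = h * ((h - 1) + l + (k - i))
      + (\<Sum>a\<in>IA. card (nbrs H a \<inter> hubs)) + (\<Sum>z\<in>IB. card (nbrs H z \<inter> hubs))"
    using deg_hub sum_card_nbrs_swap[of hubs IA H] sum_card_nbrs_swap[of hubs IB H] finites
    by (simp add: sum.distrib h_def)
  moreover have "i * (d a0 + 1 - k) \<le> (\<Sum>a\<in>IA. card (nbrs H a \<inter> hubs))"
  proof -
    have "(\<Sum>a\<in>IA. d a0 + 1 - k) \<le> (\<Sum>a\<in>IA. card (nbrs H a \<inter> hubs))"
    proof (rule sum_mono)
      fix a assume "a \<in> IA"
      then show "d a0 + 1 - k \<le> card (nbrs H a \<inter> hubs)" using deg_IA[of a] a0(2)[of a] by simp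
    qed
    then show ?thesis by (simp add: i_def)
  qed
  \<comment> \<open>Outside the hubs a vertex of \<open>IB\<close> has at most the k - i neighbours
    in \<open>A - IA\<close>, so degree k - 1 requires at least i - 1 hubs.\<close>
  moreover have "j * (i - 1) \<le> (\<Sum>z\<in>IB. card (nbrs H z \<inter> hubs))"
  proof -
    have "(\<Sum>z\<in>IB. i - 1) \<le> (\<Sum>z\<in>IB. card (nbrs H z \<inter> hubs))"
    proof (rule sum_mono)
      fix z assume z: "z \<in> IB"
      then have "k \<le> d z + 1" using mind[of z] IBsub disj(7)[of z] by (auto simp: k_def)
      then show "i - 1 \<le> card (nbrs H z \<inter> hubs)" using deg_IB[OF z] ik by simp
    qed
    then show ?thesis by (simp add: j_def)
  qed
  \<comment> \<open>No hub has a target degree above \<open>d a0\<close>, as \<open>a0\<close> lies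
    in \<open>A\<close>; strictness comes from the deficiency of \<open>s\<close>.\<close>
  moreover have "(\<Sum>x\<in>hubs. edeg H x) < h * d a0"
  proof -
    have "(\<Sum>x\<in>hubs. edeg H x) < (\<Sum>x\<in>hubs. d x)"
      using finites H(2) hL(4) deficient by (intro sum_strict_mono_ex1) (auto simp: hubs_def)
    also have "\<dots> \<le> (\<Sum>x\<in>hubs. d a0)"
      using top a0A by (intro sum_mono) (auto simp: hubs_def)
    finally show ?thesis by (simp add: h_def)
  qed
  ultimately have ineq: "h * ((h - 1) + l + (k - i)) + i * (d a0 + 1 - k) + j * (i - 1) + 1 \<le> h * d a0"
    by linarith
  have "int (h + j + l) < int i"
  proof (rule stuck_arith[of "int h" "int i" "int j" "int l" _ "int (d a0) + 1 - int k"])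
    have "int (h * ((h - 1) + l + (k - i)) + i * (d a0 + 1 - k) + j * (i - 1) + 1) \<le> int (h * d a0)"
      using ineq by (simp only: of_nat_le_iff)
    then show "int h * (int (h + j + l) - int j - int i) + int i * (int (d a0) + 1 - int k)
        + int j * (int i - 1) + 1 \<le> int h * (int (d a0) + 1 - int k)"
      using h1 i1 ik t_lo by (simp add: of_nat_diff, simp add: algebra_simps)
  qed (use h1 i1 t_lo t_hi in auto)
  then have m: "h + j + l < i" by simp
  then have ki: "k = i" "k = h + j + l + 1" using n cV ik by (auto simp: k_def)
  show "card V + 1 = 2 * card A" using cV ki by (simp add: k_def)
  have IAA: "IA = A"
    using ki(1) IAsub finites card_subset_eq[of A IA] by (simp add: k_def i_def)
  \<comment> \<open>With \<open>A - IA\<close> empty, a vertex of \<open>IB\<close> has at most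
    \<open>h\<close> neighbours, fewer than the k - 1 = h + j + l it needs.\<close>
  have IB0: "IB = {}"
  proof (rule ccontr)
    assume "IB \<noteq> {}"
    then obtain z where z: "z \<in> IB" by blast
    then have "k \<le> d z + 1" using mind[of z] IBsub disj(7)[of z] by (auto simp: k_def)
    moreover have "d z \<le> h"
      using deg_IB[OF z] ki(1) card_mono[of hubs "nbrs H z \<inter> hubs"] finites by (auto simp: h_def)
    moreover have "1 \<le> j" using z finites by (auto simp: j_def Suc_le_eq card_gt_0_iff)
    ultimately show False using ki(2) by simp
  qed
  show "card (nbrs H b \<inter> A) + card A \<le> d b + 2" if b: "b \<in> V - A"
  proof (cases "b \<in> hubs")
    case True
    have "edeg H b \<le> d b" using H(2) b by blast
    then show ?thesis
      using deg_hub[OF True] ki h1 IAA IB0 by (simp add: k_def j_def)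
  next
    case False
    then have "b \<in> L" using b hL(5) by blast
    then have "nbrs H b \<inter> A = {}" using IA_nbrs[of _ b] IAA by (auto simp: insert_commute)
    then show ?thesis using mind[of b] b by simp
  qed
qed

end

text \<open>Take a subrealization with full degrees on \<open>A\<close> and as many edges inside
  \<open>A\<close> as possible. If \<open>uv\<close> is missing, both ends have too few possible
  neighbours in \<open>A\<close> and hence neighbours \<open>x\<close>, \<open>y\<close> outside,
  possibly equal. Trading \<open>ux\<close> and \<open>vy\<close> for \<open>uv\<close> lowers only
  degrees outside \<open>A\<close>.\<close>

lemma clique_subrealization_exists:
  assumes G: "simple_on V G" and A: "A \<subseteq> V" and deg: "\<And>a. a \<in> A \<Longrightarrow> card A \<le> edeg G a + 1"
  shows "\<exists>H. simple_on V H \<and> (\<forall>v\<in>V. edeg H v \<le> edeg G v) \<and> (\<forall>a\<in>A. edeg H a = edeg G a) \<and> clique H A"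
proof -
  let ?P = "\<lambda>H. simple_on V H \<and> (\<forall>v\<in>V. edeg H v \<le> edeg G v) \<and> (\<forall>a\<in>A. edeg H a = edeg G a)"
  have finV: "finite V" using G by (simp add: simple_on_def)
  have finA: "finite A" using A finV finite_subset by blast
  have fp: "finite (pairs_on A)" by (rule finite_pairs_on[OF finA])
  have "\<exists>H. ?P H \<and> (\<forall>H'. ?P H' \<longrightarrow> card (H' \<inter> pairs_on A) \<le> card (H \<inter> pairs_on A))"
    by (rule ex_has_greatest_nat[of ?P G _ "Suc (card (pairs_on A))"]) (use G fp in \<open>auto simp: less_Suc_eq_le intro: card_mono\<close>)
  then obtain H where H: "?P H" and max: "\<And>H'. ?P H' \<Longrightarrow> card (H' \<inter> pairs_on A) \<le> card (H \<inter> pairs_on A)"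
    by blast
  have sH: "simple_on V H" and finH: "finite H" using H simple_on_finite by auto
  have "clique H A"
    unfolding clique_def
  proof (rule ccontr)
    assume "\<not> pairs_on A \<subseteq> H"
    then obtain u v where uv: "u \<in> A" "v \<in> A" "u \<noteq> v" "{u, v} \<notin> H" by (auto simp: pairs_on_def)
    have ex: "\<exists>z. z \<notin> A \<and> {x, z} \<in> H" if x: "x \<in> A" "y \<in> A" "x \<noteq> y" "{x, y} \<notin> H" for x y
    proof (rule ccontr)
      assume "\<not> ?thesis"
      then have "nbrs H x \<subseteq> A - {x, y}" using x simple_onD(3)[OF sH, of x x] by auto
      then have "card (nbrs H x) \<le> card (A - {x, y})" using finA by (intro card_mono) auto
      also have "\<dots> = card A - 2" using x finA by (simp add: card_Diff_subset)
      finally have "edeg G x \<le> card A - 2" using H x(1) edeg_eq_card_nbrs[OF sH, of x] by simp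
      moreover have "card {x, y} \<le> card A" using x finA by (intro card_mono) auto
      then have "2 \<le> card A" using x by simp
      ultimately show False using deg[OF x(1)] by simp
    qed
    obtain x where x: "x \<notin> A" "{u, x} \<in> H" using ex[of u v] uv by blast
    obtain y where y: "y \<notin> A" "{v, y} \<in> H" using ex[of v u] uv by (auto simp: insert_commute)
    let ?R = "{{u, x}, {v, y}}" and ?S = "{{u, v}}"
    let ?H = "(H - ?R) \<union> ?S"
    have e: "edeg ?H w + edeg ?R w = edeg H w + edeg ?S w" for w
      using x y uv finH by (intro edeg_exchange) auto
    have R: "edeg ?R w = (if w \<in> {v, y} then 1 else 0) + (if w \<in> {u, x} then 1 else 0)" for w
      using uv x y by (auto simp: edeg_insert doubleton_eq_iff)
    have S: "edeg ?S w = (if w \<in> {u, v} then 1 else 0)" for w by (simp add: edeg_insert)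
    have "?P ?H"
    proof (intro conjI ballI)
      show "simple_on V ?H" using sH uv A by (auto simp: simple_on_def)
      show "edeg ?H w = edeg G w" if "w \<in> A" for w
      proof -
        have "edeg ?R w = edeg ?S w" unfolding R S using that uv x y by auto
        then show ?thesis using e[of w] H that by simp
      qed
      show "edeg ?H w \<le> edeg G w" if "w \<in> V" for w
      proof -
        have "edeg ?S w \<le> edeg ?R w" unfolding R S using uv x y by auto
        then have "edeg ?H w \<le> edeg H w" using e[of w] by linarith
        then show ?thesis using H that by (meson le_trans)
      qed
    qed
    then have "card (?H \<inter> pairs_on A) \<le> card (H \<inter> pairs_on A)" by (rule max)
    moreover have "?H \<inter> pairs_on A = insert {u, v} (H \<inter> pairs_on A)" using uv x y by auto
    moreover have "card (insert {u, v} (H \<inter> pairs_on A)) = Suc (card (H \<inter> pairs_on A))"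
      using uv fp by simp
    ultimately show False by (simp only:)
  qed
  then show ?thesis using H by blast
qed

lemma clique_realization_or_split:
  assumes G: "simple_on V G" and A: "A \<subseteq> V"
    and top: "\<And>a b. a \<in> A \<Longrightarrow> b \<in> V - A \<Longrightarrow> edeg G b \<le> edeg G a"
    and mind: "\<And>v. v \<in> V \<Longrightarrow> card A \<le> edeg G v + 1" and n: "2 * card A \<le> card V + 1"
  shows "(\<exists>H. simple_on V H \<and> (\<forall>v\<in>V. edeg H v = edeg G v) \<and> clique H A) \<or>
    (card V + 1 = 2 * card A \<and> (\<exists>H. simple_on V H \<and> (\<forall>v\<in>V. edeg H v \<le> edeg G v) \<and>
      (\<forall>a\<in>A. edeg H a = edeg G a) \<and> clique H A \<and> clique H (V - A)))"
proof -
  let ?d = "edeg G"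
  have finV: "finite V" using G by (simp add: simple_on_def)
  have finA: "finite A" using A finV finite_subset by blast
  define sr where "sr H F \<longleftrightarrow> simple_on V H \<and> (\<forall>v\<in>V. edeg H v \<le> ?d v) \<and> clique H A \<and>
    (\<forall>v\<in>A \<union> F. edeg H v = ?d v)" for H F
  \<comment> \<open>The degree condition on \<open>F\<close> guarantees that the next vertex
    \<open>s\<close>, of largest degree among the rest, lies below all of \<open>F\<close>.\<close>
  define P where "P F \<longleftrightarrow> F \<subseteq> V - A \<and> (\<forall>x\<in>F. \<forall>b\<in>V - A - F. ?d b \<le> ?d x) \<and> (\<exists>H. sr H F)" for F
  have "P {}"
    using clique_subrealization_exists[OF G A] mind A by (auto simp: P_def sr_def)
  moreover have "\<forall>F. P F \<longrightarrow> card F < Suc (card V)"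
    using finV by (auto simp: P_def less_Suc_eq_le intro: card_mono)
  ultimately obtain F where F: "P F" and Fmax: "\<And>F'. P F' \<Longrightarrow> card F' \<le> card F"
    using ex_has_greatest_nat[of P "{}" card "Suc (card V)"] by blast
  have FB: "F \<subseteq> V - A" using F by (simp add: P_def)
  have finF: "finite F" using FB finV finite_subset by blast
  show ?thesis
  proof (cases "F = V - A")
    case True
    then obtain H where "sr H (V - A)" using F by (auto simp: P_def)
    then show ?thesis using A by (intro disjI1 exI[of _ H]) (auto simp: sr_def)
  next
    case False
    then have ne: "V - A - F \<noteq> {}" using FB by blast
    have "Max (?d ` (V - A - F)) \<in> ?d ` (V - A - F)" using ne finV by (intro Max_in) auto
    then obtain s where s': "s \<in> V - A - F" "?d s = Max (?d ` (V - A - F))" by auto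
    have s: "s \<in> V - A - F" "\<And>b. b \<in> V - A - F \<Longrightarrow> ?d b \<le> ?d s"
      using s' finV by (auto intro!: Max_ge)
    obtain H0 where "sr H0 F" using F by (auto simp: P_def)
    moreover have "\<forall>H. sr H F \<longrightarrow> edeg H s < Suc (?d s)" using s(1) by (auto simp: sr_def less_Suc_eq_le)
    ultimately obtain H where H: "sr H F" and Hmax: "\<And>H'. sr H' F \<Longrightarrow> edeg H' s \<le> edeg H s"
      using ex_has_greatest_nat[of "\<lambda>H. sr H F" H0 "\<lambda>H. edeg H s" "Suc (?d s)"] by blast
    have "edeg H s < ?d s"
    proof (rule ccontr)
      assume "\<not> ?thesis"
      then have "edeg H s = ?d s" using H s(1) by (auto simp: sr_def intro: antisym)
      then have "sr H (insert s F)" using H by (auto simp: sr_def)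
      then have "P (insert s F)" using F s by (auto simp: P_def)
      then have "card (insert s F) \<le> card F" by (rule Fmax)
      then show False using s(1) finF by simp
    qed
    then interpret stuck_subrealization V A F s ?d G H
      using G H A FB s F top Hmax
      by unfold_locales (auto simp: sr_def P_def)
    have st: "card V + 1 = 2 * card A"
      by (rule stuck_structure(1)) (use mind n in auto)
    have st2: "card (nbrs H b \<inter> A) + card A \<le> ?d b + 2" if "b \<in> V - A" for b
      by (rule stuck_structure(2)) (use mind n that in auto)
    have cB: "card (V - A) + 1 = card A"
      using st A finA finV by (simp add: card_Diff_subset)
    \<comment> \<open>\<open>stuck_structure\<close> leaves each \<open>b\<close> room for k - 2
      neighbours besides those in \<open>A\<close>, exactly the number of other vertices in
      \<open>V - A\<close>.\<close>
    let ?K = "H \<union> pairs_on (V - A)"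
    have sK: "simple_on V ?K"
      using H(1) pairs_on_mono[of "V - A" V] by (auto simp: simple_on_def)
    note sH = H(1)
    have KA: "edeg ?K a = ?d a" if a: "a \<in> A" for a
    proof -
      have "nbrs ?K a = nbrs H a" using a by auto
      then show ?thesis
        using full[of a] a by (simp add: edeg_eq_card_nbrs[OF sK] flip: edeg_eq_card_nbrs[OF sH])
    qed
    moreover have "edeg ?K b \<le> ?d b" if b: "b \<in> V - A" for b
    proof -
      have "nbrs ?K b \<subseteq> (V - A - {b}) \<union> (nbrs H b \<inter> A)"
        using b simple_onD(2)[OF sH, of b] simple_onD(3)[OF sH, of b b] by auto
      then have "card (nbrs ?K b) \<le> card ((V - A - {b}) \<union> (nbrs H b \<inter> A))"
        using finV finA by (intro card_mono) auto
      also have "\<dots> \<le> card (V - A - {b}) + card (nbrs H b \<inter> A)" by (rule card_Un_le)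
      also have "card (V - A - {b}) = card A - 2" using b finV cB by simp
      finally show ?thesis
        using st2[OF b] b cB finV card_gt_0_iff[of "V - A"]
        by (auto simp: edeg_eq_card_nbrs[OF sK])
    qed
    ultimately have "\<forall>v\<in>V. edeg ?K v \<le> ?d v" by (metis DiffI order_refl)
    moreover have "clique ?K A" "clique ?K (V - A)" using H(3) by (auto simp: clique_def)
    ultimately show ?thesis using sK KA st by blast
  qed
qed

section \<open>Realizations containing a clique with a subdivided star\<close>

text \<open>\<open>\<beta> a\<close> is the vertex subdividing the edge \<open>ua\<close>. Whether
  \<open>ua\<close> itself belongs to \<open>H\<close> is left open, and \<open>L = {}\<close> gives
  an ordinary clique, so both outcomes of the clique construction have the same form.\<close>

definition star_clique :: "'a set \<Rightarrow> 'a set set \<Rightarrow> 'a set \<Rightarrow> 'a \<Rightarrow> 'a set \<Rightarrow> ('a \<Rightarrow> 'a) \<Rightarrow> bool" where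
  "star_clique V H A u L \<beta> \<longleftrightarrow> A \<subseteq> V \<and> u \<in> A \<and> L \<subseteq> A - {u} \<and> inj_on \<beta> L \<and> \<beta> ` L \<subseteq> V - A \<and>
     pairs_on A - (\<lambda>a. {u, a}) ` L \<subseteq> H \<and> (\<forall>a\<in>L. {u, \<beta> a} \<in> H \<and> {a, \<beta> a} \<in> H)"

lemma edeg_image:
  assumes "inj_on g D"
  shows "edeg (g ` D) v = card {b \<in> D. v \<in> g b}"
proof -
  have "{e \<in> g ` D. v \<in> e} = g ` {b \<in> D. v \<in> g b}" by auto
  then show ?thesis using assms unfolding edeg_def by (simp add: card_image inj_on_def)
qed

lemma perfect_matching_exists:
  assumes "finite D" "even (card D)"
  shows "\<exists>M\<subseteq>pairs_on D. \<forall>v. edeg M v = (if v \<in> D then 1 else 0)"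
  using assms
proof (induction "card D" arbitrary: D rule: less_induct)
  case less
  show ?case
  proof (cases "D = {}")
    case True
    then show ?thesis by (intro exI[of _ "{}"]) auto
  next
    case False
    then obtain x where x: "x \<in> D" by blast
    have "card D \<noteq> 1" using less.prems(2) by auto
    then have "D \<noteq> {x}" by auto
    then obtain y where y: "y \<in> D" "y \<noteq> x" using x by blast
    let ?D = "D - {x, y}"
    have cD: "card ?D = card D - 2" using x y less.prems(1) by (simp add: card_Diff_subset)
    have "card {x, y} \<le> card D" using x y less.prems(1) by (intro card_mono) auto
    then have "2 \<le> card D" using y by simp
    then have "card ?D < card D" "even (card ?D)" using cD less.prems(2) by auto
    then obtain M where M: "M \<subseteq> pairs_on ?D" "\<forall>v. edeg M v = (if v \<in> ?D then 1 else 0)"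
      using less.hyps[of ?D] less.prems(1) by auto
    have finM: "finite M" using M(1) finite_pairs_on[of ?D] less.prems(1) finite_subset by blast
    have "{x, y} \<notin> M" using M(1) by auto
    then have "\<forall>v. edeg (insert {x, y} M) v = (if v \<in> D then 1 else 0)"
      using M(2) finM x y by (auto simp: edeg_insert)
    moreover have "insert {x, y} M \<subseteq> pairs_on D"
      using M(1) pairs_on_mono[of ?D D] x y by auto
    ultimately show ?thesis by blast
  qed
qed

text \<open>\<open>u\<close>, of least degree in \<open>A\<close>, becomes the centre of the star.
  Each vertex of \<open>A\<close> needs at least \<open>d u + 1 - |A|\<close> neighbours outside,
  while no vertex outside has a target above \<open>d u\<close>; all estimates below weigh these two
  facts against each other.\<close>

locale split_subrealization =
  fixes V A :: "'a set" and d :: "'a \<Rightarrow> nat" and u :: 'a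
  assumes finV: "finite V" and A: "A \<subseteq> V" and card_V: "card V + 1 = 2 * card A"
    and u: "u \<in> A" "\<And>a. a \<in> A \<Longrightarrow> d u \<le> d a"
    and top: "\<And>b. b \<in> V - A \<Longrightarrow> d b \<le> d u"
    and mind: "card A \<le> d u + 1"
    and even_d: "even (\<Sum>v\<in>V. d v)"
begin

section \<open>Balancing the edges between two cliques\<close>

abbreviation "B \<equiv> V - A"

definition split_sub :: "'a set set \<Rightarrow> bool" where
  "split_sub H \<longleftrightarrow> simple_on V H \<and> (\<forall>v\<in>V. edeg H v \<le> d v) \<and> (\<forall>a\<in>A. edeg H a = d a) \<and>
     clique H A \<and> clique H B"

lemma fin: "finite A" "finite B" "card B + 1 = card A" "0 < card A"
proof -
  show f: "finite A" "finite B" using finV A finite_subset by auto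
  show "card B + 1 = card A"
    using card_V A f finV card_mono[of V A] by (simp add: card_Diff_subset)
  then show "0 < card A" by simp
qed

lemma split_deg:
  assumes "split_sub H"
  shows "b \<in> B \<Longrightarrow> edeg H b + 2 = card A + card (nbrs H b \<inter> A)"
    and "a \<in> A \<Longrightarrow> d a + 1 = card A + card (nbrs H a \<inter> B)"
proof -
  have sH: "simple_on V H" and cl: "clique H A" "clique H B" using assms by (auto simp: split_sub_def)
  show "edeg H b + 2 = card A + card (nbrs H b \<inter> A)" if b: "b \<in> B"
  proof -
    have "nbrs H b = (B - {b}) \<union> (nbrs H b \<inter> A)"
    proof (intro equalityI subsetI)
      fix y assume "y \<in> nbrs H b"
      then show "y \<in> (B - {b}) \<union> (nbrs H b \<inter> A)" using simple_onD(2,3)[OF sH, of b y] by auto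
    next
      fix y assume "y \<in> (B - {b}) \<union> (nbrs H b \<inter> A)"
      then show "y \<in> nbrs H b" using cliqueD[OF cl(2) b, of y] by auto
    qed
    then have "card (nbrs H b) = card (B - {b}) + card (nbrs H b \<inter> A)"
      using fin card_Un_disjoint[of "B - {b}" "nbrs H b \<inter> A"] by auto
    moreover have "0 < card B" using b fin card_gt_0_iff by blast
    ultimately show ?thesis using b fin by (simp add: edeg_eq_card_nbrs[OF sH])
  qed
  show "d a + 1 = card A + card (nbrs H a \<inter> B)" if a: "a \<in> A"
  proof -
    have "nbrs H a = (A - {a}) \<union> (nbrs H a \<inter> B)"
    proof (intro equalityI subsetI)
      fix y assume "y \<in> nbrs H a"
      then show "y \<in> (A - {a}) \<union> (nbrs H a \<inter> B)" using simple_onD(2,3)[OF sH, of a y] by auto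
    next
      fix y assume "y \<in> (A - {a}) \<union> (nbrs H a \<inter> B)"
      then show "y \<in> nbrs H a" using cliqueD[OF cl(1) a, of y] by auto
    qed
    then have "card (nbrs H a) = card (A - {a}) + card (nbrs H a \<inter> B)"
      using fin card_Un_disjoint[of "A - {a}" "nbrs H a \<inter> B"] by auto
    then show ?thesis using a fin assms by (simp add: edeg_eq_card_nbrs[OF sH] split_sub_def)
  qed
qed

text \<open>The edges between the cliques are counted from the side of \<open>A\<close>. With
  \<open>k = |A|\<close> and \<open>t = d u\<close> the bound equals \<open>k t - 2 k + 2\<close>,
  the number behind the arithmetic of the next three results.\<close>

lemma sum_B_deg:
  assumes "split_sub H"
  shows "card B * (card A - 2) + card A * (d u + 1 - card A) \<le> (\<Sum>b\<in>B. edeg H b)"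
proof -
  have "card A * (d u + 1 - card A) = (\<Sum>a\<in>A. d u + 1 - card A)" by simp
  also have "\<dots> \<le> (\<Sum>a\<in>A. card (nbrs H a \<inter> B))"
  proof (rule sum_mono)
    fix a assume "a \<in> A"
    then show "d u + 1 - card A \<le> card (nbrs H a \<inter> B)" using split_deg(2)[OF assms, of a] u(2)[of a] by simp
  qed
  also have "\<dots> = (\<Sum>b\<in>B. card (nbrs H b \<inter> A))" using fin by (intro sum_card_nbrs_swap)
  finally have "card A * (d u + 1 - card A) \<le> (\<Sum>b\<in>B. card (nbrs H b \<inter> A))" .
  moreover have "(\<Sum>b\<in>B. edeg H b) = (\<Sum>b\<in>B. (card A - 2) + card (nbrs H b \<inter> A))"
  proof (rule sum.cong[OF refl])
    fix b assume b: "b \<in> B"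
    then have "0 < card B" using fin card_gt_0_iff by blast
    then show "edeg H b = (card A - 2) + card (nbrs H b \<inter> A)"
      using split_deg(1)[OF assms b] fin by simp
  qed
  ultimately show ?thesis by (simp add: sum.distrib)
qed

lemma shift_edge:
  assumes H: "split_sub H" and a: "a \<in> A" and b: "b \<in> B" "b' \<in> B" "b \<noteq> b'"
    and ab: "{a, b'} \<in> H" "{a, b} \<notin> H" and lt: "edeg H b < d b"
  obtains H' where "split_sub H'" "edeg H' b = edeg H b + 1" "edeg H' b' + 1 = edeg H b'"
    "\<And>v. v \<noteq> b \<Longrightarrow> v \<noteq> b' \<Longrightarrow> edeg H' v = edeg H v" "\<And>v. v \<in> A \<Longrightarrow> v \<noteq> a \<Longrightarrow> nbrs H' v = nbrs H v"
proof
  let ?H = "(H - {{a, b'}}) \<union> {{a, b}}"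
  have sH: "simple_on V H" using H by (simp add: split_sub_def)
  have ne: "a \<noteq> b" "a \<noteq> b'" using a b by auto
  have ex: "edeg ?H v + edeg {{a, b'}} v = edeg H v + edeg {{a, b}} v" for v
    using ab simple_on_finite[OF sH] by (intro edeg_exchange) auto
  show b1: "edeg ?H b = edeg H b + 1" using ex[of b] ne b by (simp add: edeg_insert)
  show b2: "edeg ?H b' + 1 = edeg H b'" using ex[of b'] ne b by (simp add: edeg_insert)
  show oth: "edeg ?H v = edeg H v" if "v \<noteq> b" "v \<noteq> b'" for v
    using ex[of v] that by (auto simp: edeg_insert split: if_splits)
  show "nbrs ?H v = nbrs H v" if "v \<in> A" "v \<noteq> a" for v
    using that b by (auto simp: doubleton_eq_iff)
  show "split_sub ?H"
    unfolding split_sub_def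
  proof (intro conjI ballI)
    show "simple_on V ?H" using sH a b ne A by (auto simp: simple_on_def)
    show "edeg ?H v \<le> d v" if v: "v \<in> V" for v
    proof -
      have "edeg H v \<le> d v" using v H by (simp add: split_sub_def)
      then show ?thesis using oth[of v] b1 b2 lt by (cases "v = b"; cases "v = b'") auto
    qed
    show "edeg ?H v = d v" if "v \<in> A" for v
      using that oth[of v] b H by (auto simp: split_sub_def)
    show "clique ?H A" "clique ?H B"
      using H a b by (auto simp: split_sub_def clique_def)
  qed
qed

text \<open>Minimize the deficiency in excess of one edge per vertex. If \<open>b\<close> lacks two
  edges, no edge of a saturated \<open>b'\<close> can be moved to \<open>b\<close>, so in
  \<open>A\<close> all neighbours of \<open>b'\<close> are neighbours of \<open>b\<close>, whence
  \<open>d b' \<le> d u - 2\<close>. Then all of \<open>B\<close> is too far below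
  \<open>d u\<close> for \<open>sum_B_deg\<close>.\<close>

lemma balanced_exists:
  assumes "split_sub H0"
  shows "\<exists>H. split_sub H \<and> (\<forall>b\<in>B. d b \<le> edeg H b + 1)"
proof -
  \<comment> \<open>Truncated subtraction lets vertices lacking at most one edge contribute
    nothing.\<close>
  define ex where "ex H = (\<Sum>b\<in>B. d b - edeg H b - 1)" for H
  obtain H where H: "split_sub H" and min: "\<And>H'. split_sub H' \<Longrightarrow> ex H \<le> ex H'"
    using ex_has_least_nat[of split_sub H0 ex] assms by blast
  have "d b \<le> edeg H b + 1" if b: "b \<in> B" for b
  proof (rule ccontr)
    assume "\<not> ?thesis"
    then have bd: "edeg H b + 2 \<le> d b" by simp
    define B0 where "B0 = {b' \<in> B. edeg H b' = d b'}"
    have B0: "B0 \<subseteq> B" "finite B0" "b \<notin> B0" using fin bd by (auto simp: B0_def)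
    have B0_le: "d b' + 2 \<le> d u" if b': "b' \<in> B0" for b'
    proof -
      have b'B: "b' \<in> B" "edeg H b' = d b'" "b \<noteq> b'" using b' bd by (auto simp: B0_def)
      have "nbrs H b' \<inter> A \<subseteq> nbrs H b \<inter> A"
      proof (rule ccontr)
        assume "\<not> ?thesis"
        then obtain a where "a \<in> A" "a \<in> nbrs H b'" "a \<notin> nbrs H b" by blast
        then have a: "a \<in> A" "{a, b'} \<in> H" "{a, b} \<notin> H" by (simp_all add: insert_commute)
        obtain H' where H': "split_sub H'" "edeg H' b = edeg H b + 1" "edeg H' b' + 1 = edeg H b'"
          "\<And>v. v \<noteq> b \<Longrightarrow> v \<noteq> b' \<Longrightarrow> edeg H' v = edeg H v"
          "\<And>v. v \<in> A \<Longrightarrow> v \<noteq> a \<Longrightarrow> nbrs H' v = nbrs H v"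
          by (rule shift_edge[OF H a(1) b b'B(1,3) a(2,3)]) (use bd in auto)
        have "ex H' < ex H"
          unfolding ex_def
        proof (rule sum_strict_mono_ex1[OF fin(2)])
          show "\<forall>x\<in>B. d x - edeg H' x - 1 \<le> d x - edeg H x - 1"
          proof
            fix x
            show "d x - edeg H' x - 1 \<le> d x - edeg H x - 1"
              using H'(2,3) H'(4)[of x] b'B(2) by (cases "x = b"; cases "x = b'") auto
          qed
          show "\<exists>x\<in>B. d x - edeg H' x - 1 < d x - edeg H x - 1"
            using b H'(2) bd by (intro bexI[of _ b]) auto
        qed
        then show False using min[OF H'(1)] by simp
      qed
      then have "card (nbrs H b' \<inter> A) \<le> card (nbrs H b \<inter> A)" using fin by (intro card_mono) auto
      then have "edeg H b' \<le> edeg H b" using split_deg(1)[OF H b] split_deg(1)[OF H b'B(1)] by simp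
      then show ?thesis using b'B bd top[OF b] by simp
    qed
    let ?k = "card A" and ?t = "d u" and ?\<beta> = "card B0"
    have "(\<Sum>x\<in>B. d x) + 2 * ?\<beta> \<le> card B * ?t"
    proof -
      have "(\<Sum>x\<in>B. d x + (if x \<in> B0 then 2 else 0)) \<le> (\<Sum>x\<in>B. ?t)"
        using B0_le top by (intro sum_mono) auto
      moreover have "(\<Sum>x\<in>B. (if x \<in> B0 then 2 else 0)) = 2 * ?\<beta>"
        using fin B0 by (simp add: sum.If_cases Int_absorb1)
      ultimately show ?thesis by (simp add: sum.distrib)
    qed
    \<comment> \<open>Each of the \<open>card B - ?\<beta>\<close> unsaturated vertices lacks an
      edge, and \<open>b\<close> lacks a second one.\<close>
    moreover have "(\<Sum>x\<in>B. edeg H x) + card B + 1 \<le> (\<Sum>x\<in>B. d x) + ?\<beta>"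
    proof -
      have "(\<Sum>x\<in>B. edeg H x + 1) < (\<Sum>x\<in>B. d x + (if x \<in> B0 then 1 else 0))"
      proof (rule sum_strict_mono_ex1[OF fin(2)])
        show "\<forall>x\<in>B. edeg H x + 1 \<le> d x + (if x \<in> B0 then 1 else 0)"
        proof
          fix x assume x: "x \<in> B"
          then have "edeg H x \<le> d x" using H by (simp add: split_sub_def)
          then show "edeg H x + 1 \<le> d x + (if x \<in> B0 then 1 else 0)"
            using x by (auto simp: B0_def)
        qed
        show "\<exists>x\<in>B. edeg H x + 1 < d x + (if x \<in> B0 then 1 else 0)" using b bd B0(3) by (intro bexI[of _ b]) auto
      qed
      moreover have "(\<Sum>x\<in>B. (if x \<in> B0 then 1 else 0)) = ?\<beta>"
        using fin B0 by (simp add: sum.If_cases Int_absorb1)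
      ultimately show ?thesis by (simp add: sum.distrib sum_Suc)
    qed
    ultimately have "card B * (?k - 2) + ?k * (?t + 1 - ?k) + card B + 1 + ?\<beta> \<le> card B * ?t"
      using sum_B_deg[OF H] by linarith
    then have "int (card B * (?k - 2) + ?k * (?t + 1 - ?k) + card B + 1 + ?\<beta>) \<le> int (card B * ?t)"
      by (simp only: of_nat_le_iff)
    moreover have "2 \<le> ?k" using b fin card_gt_0_iff[of B] by auto
    moreover have "int (card B) = int ?k - 1" using fin(3) by simp
    ultimately have "int ?t + int ?\<beta> + 2 \<le> int ?k"
      using mind by (simp add: of_nat_diff, simp add: algebra_simps)
    then show False using mind by simp
  qed
  then show ?thesis using H by blast
qed

text \<open>Deficient vertices are to become new neighbours of \<open>u\<close>, so they must not be
  adjacent to it yet. If a deficient \<open>b\<close> is, counting yields a saturated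
  \<open>b'\<close> of degree \<open>d u\<close> not adjacent to \<open>u\<close>; moving an edge
  from \<open>b'\<close> to \<open>b\<close> passes the deficiency on to \<open>b'\<close>.\<close>

lemma balanced_avoiding_exists:
  assumes "split_sub H0"
  shows "\<exists>H. split_sub H \<and> (\<forall>b\<in>B. d b \<le> edeg H b + 1) \<and> (\<forall>b\<in>B. {u, b} \<in> H \<longrightarrow> edeg H b = d b)"
proof -
  let ?P = "\<lambda>H. split_sub H \<and> (\<forall>b\<in>B. d b \<le> edeg H b + 1)"
  define m where "m H = card {b \<in> B. {u, b} \<in> H \<and> edeg H b \<noteq> d b}" for H
  obtain H1 where "?P H1" using balanced_exists[OF assms] by blast
  then obtain H where H: "?P H" and min: "\<And>H'. ?P H' \<Longrightarrow> m H \<le> m H'"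
    using ex_has_least_nat[of ?P H1 m] by blast
  have sp: "split_sub H" using H by blast
  have "edeg H b = d b" if b: "b \<in> B" "{u, b} \<in> H" for b
  proof (rule ccontr)
    assume nb: "edeg H b \<noteq> d b"
    have le: "edeg H x \<le> d x" if "x \<in> B" for x using that sp by (simp add: split_sub_def)
    have lt: "edeg H b < d b" using nb le[OF b(1)] by simp
    let ?k = "card A" and ?t = "d u"
    define T where "T = {x \<in> B. edeg H x = d x \<and> d x = ?t}"
    have T: "T \<subseteq> B" "finite T" "b \<notin> T" using fin nb by (auto simp: T_def)
    have k2: "2 \<le> ?k" using b fin card_gt_0_iff[of B] by auto
    have "(\<Sum>x\<in>B. edeg H x) \<le> (\<Sum>x\<in>B. (?t - 1) + (if x \<in> T then 1 else 0))"
    proof (rule sum_mono)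
      fix x assume x: "x \<in> B"
      then show "edeg H x \<le> (?t - 1) + (if x \<in> T then 1 else 0)"
        using le[OF x] top[OF x] by (auto simp: T_def)
    qed
    also have "\<dots> = card B * (?t - 1) + card T"
      using fin T by (simp add: sum.distrib sum.If_cases Int_absorb1)
    finally have "card B * (?k - 2) + ?k * (?t + 1 - ?k) \<le> card B * (?t - 1) + card T"
      using sum_B_deg[OF sp] by linarith
    then have "int (card B * (?k - 2) + ?k * (?t + 1 - ?k)) \<le> int (card B * (?t - 1) + card T)"
      by (simp only: of_nat_le_iff)
    moreover have "int (card B) = int ?k - 1" using fin(3) by simp
    ultimately have "int ?t + 1 - int ?k \<le> int (card T)"
      using mind k2 by (simp add: of_nat_diff, simp add: algebra_simps)
    then have cT: "?t + 1 \<le> ?k + card T" by simp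
    \<comment> \<open>\<open>u\<close> has exactly \<open>t + 1 - k\<close> neighbours in
      \<open>B\<close>, and one of them is \<open>b\<close>, which is not in \<open>T\<close>; so
      \<open>T\<close> is too large to consist of neighbours of \<open>u\<close>.\<close>
    have "\<exists>b'\<in>T. {u, b'} \<notin> H"
    proof (rule ccontr)
      assume "\<not> ?thesis"
      then have "insert b T \<subseteq> nbrs H u \<inter> B" using T b by auto
      then have "card (insert b T) \<le> card (nbrs H u \<inter> B)" using fin by (intro card_mono) auto
      then show False using split_deg(2)[OF sp u(1)] T cT by simp
    qed
    then obtain b' where b': "b' \<in> B" "edeg H b' = d b'" "d b' = ?t" "{u, b'} \<notin> H" by (auto simp: T_def)
    have "edeg H b < edeg H b'" using lt b' top[OF b(1)] by simp
    then have "card (nbrs H b \<inter> A) < card (nbrs H b' \<inter> A)"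
      using split_deg(1)[OF sp b(1)] split_deg(1)[OF sp b'(1)] by simp
    then have "\<not> nbrs H b' \<inter> A \<subseteq> nbrs H b \<inter> A"
      using card_mono[of "nbrs H b \<inter> A" "nbrs H b' \<inter> A"] fin by auto
    then obtain a where "a \<in> A" "a \<in> nbrs H b'" "a \<notin> nbrs H b" by blast
    then have a: "a \<in> A" "{a, b'} \<in> H" "{a, b} \<notin> H" by (simp_all add: insert_commute)
    have ne: "b \<noteq> b'" "u \<noteq> a" using b b' a by auto
    obtain H' where H': "split_sub H'" "edeg H' b = edeg H b + 1" "edeg H' b' + 1 = edeg H b'"
        "\<And>v. v \<noteq> b \<Longrightarrow> v \<noteq> b' \<Longrightarrow> edeg H' v = edeg H v"
        "\<And>v. v \<in> A \<Longrightarrow> v \<noteq> a \<Longrightarrow> nbrs H' v = nbrs H v"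
      by (rule shift_edge[OF sp a(1) b(1) b'(1) ne(1) a(2,3) lt]) blast
    have nu: "{u, x} \<in> H' \<longleftrightarrow> {u, x} \<in> H" for x using H'(5)[OF u(1) ne(2)] by (metis in_nbrs)
    have "?P H'"
    proof (intro conjI ballI H'(1))
      fix x assume x: "x \<in> B"
      then have "d x \<le> edeg H x + 1" using H by blast
      then show "d x \<le> edeg H' x + 1"
        using H'(2,3) H'(4)[of x] b'(2) by (cases "x = b"; cases "x = b'") auto
    qed
    moreover have "m H' < m H"
      unfolding m_def
    proof (rule psubset_card_mono)
      have "d b \<le> edeg H b + 1" using H b(1) by blast
      then have "edeg H' b = d b" using H'(2) lt by simp
      moreover have "edeg H x \<noteq> d x" if "{u, x} \<in> H" "edeg H' x \<noteq> d x" "x \<noteq> b" for x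
        using H'(4)[of x] that b'(4) by (cases "x = b'") auto
      ultimately show "{b \<in> B. {u, b} \<in> H' \<and> edeg H' b \<noteq> d b} \<subset> {b \<in> B. {u, b} \<in> H \<and> edeg H b \<noteq> d b}"
        using b nb nu by blast
    qed (use fin in auto)
    ultimately show False using min[of H'] by simp
  qed
  then show ?thesis using H by blast
qed

text \<open>Each \<open>b\<close> in \<open>D\<close> gets its own leaf \<open>\<phi> b\<close>, and
  the path through \<open>b\<close> replaces the edge from \<open>u\<close> to
  \<open>\<phi> b\<close>. Then \<open>u\<close> and the leaves keep their degrees, while
  \<open>b\<close> gains two edges and loses one to the matching, a net gain of the one it
  lacked.\<close>

lemma star_realization:
  assumes "split_sub H0"
  shows "\<exists>H L \<beta>. simple_on V H \<and> (\<forall>v\<in>V. edeg H v = d v) \<and> star_clique V H A u L \<beta>"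
proof -
  obtain H where sp: "split_sub H" and near: "\<And>b. b \<in> B \<Longrightarrow> d b \<le> edeg H b + 1"
    and avoid: "\<And>b. b \<in> B \<Longrightarrow> {u, b} \<in> H \<Longrightarrow> edeg H b = d b"
    using balanced_avoiding_exists[OF assms] by blast
  have sH: "simple_on V H" and degA: "\<And>a. a \<in> A \<Longrightarrow> edeg H a = d a"
    and clA: "clique H A" and clB: "clique H B" and le: "\<And>v. v \<in> V \<Longrightarrow> edeg H v \<le> d v"
    using sp by (auto simp: split_sub_def)
  define D where "D = {b \<in> B. edeg H b \<noteq> d b}"
  have D: "D \<subseteq> B" "finite D" using fin by (auto simp: D_def)
  have degD: "d v = edeg H v + (if v \<in> D then 1 else 0)" if "v \<in> V" for v
    using near[of v] le[of v] degA[of v] that A by (auto simp: D_def)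
  have uD: "{u, b} \<notin> H" if "b \<in> D" for b using avoid[of b] that by (auto simp: D_def)
  let ?k = "card A" and ?t = "d u"
  have evenD: "even (card D)"
  proof -
    have "(\<Sum>v\<in>V. d v) = (\<Sum>v\<in>V. edeg H v + (if v \<in> D then 1 else 0))"
      using degD by (rule sum.cong[OF refl])
    also have "\<dots> = (\<Sum>v\<in>V. edeg H v) + card D"
      using D A finV by (simp add: sum.distrib sum.If_cases) (metis Diff_subset Int_absorb1 subset_trans)
    finally show ?thesis using even_d even_sum_edeg[OF sH] by simp
  qed
  \<comment> \<open>Counting gives \<open>|D| + d u \<le> 2 k - 2\<close>, and \<open>b\<close> has
    at most \<open>d u + 1 - k\<close> neighbours in \<open>A\<close>. So every single
    \<open>b\<close> has at least \<open>|D|\<close> candidates, and Hall's condition is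
    immediate.\<close>
  have cand: "card D \<le> card (A - {u} - nbrs H b)" if b: "b \<in> D" for b
  proof -
    have bB: "b \<in> B" using b D by blast
    have k2: "2 \<le> ?k" using bB fin card_gt_0_iff[of B] by auto
    have "(\<Sum>x\<in>B. edeg H x) + card D = (\<Sum>x\<in>B. d x)"
    proof -
      have "(\<Sum>x\<in>B. d x) = (\<Sum>x\<in>B. edeg H x + (if x \<in> D then 1 else 0))"
        using degD by (intro sum.cong) auto
      then show ?thesis using D fin by (simp add: sum.distrib sum.If_cases Int_absorb1)
    qed
    also have "\<dots> \<le> card B * ?t" using sum_bounded_above[of B d ?t] top by simp
    finally have "card B * (?k - 2) + ?k * (?t + 1 - ?k) + card D \<le> card B * ?t"
      using sum_B_deg[OF sp] by linarith
    then have "int (card B * (?k - 2) + ?k * (?t + 1 - ?k) + card D) \<le> int (card B * ?t)"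
      by (simp only: of_nat_le_iff)
    moreover have "int (card B) = int ?k - 1" using fin(3) by simp
    ultimately have "int (card D) + int ?t \<le> 2 * int ?k - 2"
      using mind k2 by (simp add: of_nat_diff, simp add: algebra_simps)
    moreover have "card (nbrs H b \<inter> A) + ?k \<le> ?t + 1"
      using split_deg(1)[OF sp bB] degD[of b] b bB top[OF bB] by simp
    moreover have "card (A - {u} - nbrs H b) + card (nbrs H b \<inter> A) + 1 = ?k"
    proof -
      have "insert u (A - {u} - nbrs H b) \<union> (nbrs H b \<inter> A) = A"
        using u(1) by auto
      moreover have "insert u (A - {u} - nbrs H b) \<inter> (nbrs H b \<inter> A) = {}"
        using uD[OF b] by (auto simp: insert_commute)
      ultimately have "?k = card (insert u (A - {u} - nbrs H b)) + card (nbrs H b \<inter> A)"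
        using fin card_Un_disjoint[of "insert u (A - {u} - nbrs H b)" "nbrs H b \<inter> A"] by simp
      then show ?thesis using fin by simp
    qed
    ultimately show ?thesis by linarith
  qed
  have "\<exists>\<phi>. inj_on \<phi> D \<and> (\<forall>b\<in>D. \<phi> b \<in> A - {u} - nbrs H b)"
  proof (rule hall_transversal)
    fix J assume J: "J \<subseteq> D"
    show "card J \<le> card (\<Union>b\<in>J. A - {u} - nbrs H b)"
    proof (cases "J = {}")
      case False
      then obtain b where b: "b \<in> J" by blast
      have "card J \<le> card D" using J D by (intro card_mono)
      also have "\<dots> \<le> card (A - {u} - nbrs H b)" using cand b J by blast
      also have "\<dots> \<le> card (\<Union>b\<in>J. A - {u} - nbrs H b)"
        using b fin by (intro card_mono) (auto intro: finite_subset[of _ A])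
      finally show ?thesis .
    qed simp
  qed (use D fin in auto)
  then obtain \<phi> where inj: "inj_on \<phi> D"
    and \<phi>: "\<And>b. b \<in> D \<Longrightarrow> \<phi> b \<in> A" "\<And>b. b \<in> D \<Longrightarrow> \<phi> b \<noteq> u" "\<And>b. b \<in> D \<Longrightarrow> {\<phi> b, b} \<notin> H"
    by (auto simp: insert_commute)
  obtain M where M: "M \<subseteq> pairs_on D" "\<And>v. edeg M v = (if v \<in> D then 1 else 0)"
    using perfect_matching_exists[OF D(2) evenD] by blast
  have DA: "b \<notin> A" "b \<noteq> u" "b \<in> V" if "b \<in> D" for b using that D u(1) by auto
  define R1 where "R1 = (\<lambda>b. {u, \<phi> b}) ` D"
  define S1 where "S1 = (\<lambda>b. {u, b}) ` D"
  define S2 where "S2 = (\<lambda>b. {\<phi> b, b}) ` D"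
  have finM: "finite M" using M(1) finite_pairs_on[OF D(2)] finite_subset by blast
  have degR: "edeg (R1 \<union> M) v = card {b \<in> D. v \<in> {u, \<phi> b}} + (if v \<in> D then 1 else 0)" for v
  proof -
    have "R1 \<inter> M = {}"
      using M(1) DA u(1) by (auto simp: R1_def)
    moreover have "edeg R1 v = card {b \<in> D. v \<in> {u, \<phi> b}}"
      unfolding R1_def using inj \<phi>(2) by (intro edeg_image) (auto simp: inj_on_def doubleton_eq_iff)
    ultimately show ?thesis using edeg_union[of R1 M v] finM D M(2) by (simp add: R1_def)
  qed
  have degS: "edeg (S1 \<union> S2) v = card {b \<in> D. v \<in> {u, b}} + card {b \<in> D. v \<in> {\<phi> b, b}}" for v
  proof -
    have "S1 \<inter> S2 = {}"
    proof (rule ccontr)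
      assume "S1 \<inter> S2 \<noteq> {}"
      then obtain b b' where b: "b' \<in> D" "{u, b} = {\<phi> b', b'}" by (auto simp: S1_def S2_def)
      then show False using \<phi>(2)[of b'] DA(2)[of b'] by (auto simp: doubleton_eq_iff)
    qed
    moreover have "edeg S1 v = card {b \<in> D. v \<in> {u, b}}"
      unfolding S1_def by (intro edeg_image) (auto simp: inj_on_def doubleton_eq_iff)
    moreover have "edeg S2 v = card {b \<in> D. v \<in> {\<phi> b, b}}"
      unfolding S2_def using \<phi>(1) DA(1) by (intro edeg_image) (auto simp: inj_on_def doubleton_eq_iff)
    ultimately show ?thesis using edeg_union[of S1 S2 v] D by (simp add: S1_def S2_def)
  qed
  let ?H = "(H - (R1 \<union> M)) \<union> (S1 \<union> S2)"
  have RH: "R1 \<union> M \<subseteq> H"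
  proof -
    have "R1 \<subseteq> H" using cliqueD[OF clA u(1)] \<phi> by (auto simp: R1_def)
    moreover have "M \<subseteq> H" using M(1) pairs_on_mono[OF D(1)] clB by (auto simp: clique_def)
    ultimately show ?thesis by blast
  qed
  have SH: "(S1 \<union> S2) \<inter> H = {}" using uD \<phi>(3) by (auto simp: S1_def S2_def)
  have ex: "edeg ?H v + edeg (R1 \<union> M) v = edeg H v + edeg (S1 \<union> S2) v" for v
    using RH SH simple_on_finite[OF sH] D by (intro edeg_exchange) (auto simp: S1_def S2_def)
  have deg: "edeg ?H v = d v" if v: "v \<in> V" for v
  proof -
    consider "v = u" | "v \<in> A" "v \<noteq> u" | "v \<notin> A" by blast
    then have "edeg (S1 \<union> S2) v = edeg (R1 \<union> M) v + (if v \<in> D then 1 else 0)"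
    proof cases
      case 1
      then have eq: "{b \<in> D. v \<in> {u, b}} = D" "{b \<in> D. v \<in> {u, \<phi> b}} = D" "{b \<in> D. v \<in> {\<phi> b, b}} = {}"
        and "v \<notin> D"
        using \<phi>(2) DA(2) by auto
      then show ?thesis unfolding degR degS eq by simp
    next
      case 2
      then have eq: "{b \<in> D. v \<in> {u, b}} = {}" "{b \<in> D. v \<in> {\<phi> b, b}} = {b \<in> D. v \<in> {u, \<phi> b}}"
        and "v \<notin> D"
        using DA(1) by auto
      then show ?thesis unfolding degR degS eq by simp
    next
      case 3
      then have eq: "{b \<in> D. v \<in> {u, b}} = {b \<in> D. b = v}" "{b \<in> D. v \<in> {u, \<phi> b}} = {}"
        "{b \<in> D. v \<in> {\<phi> b, b}} = {b \<in> D. b = v}"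
        using u(1) \<phi>(1) by auto
      have "{b \<in> D. b = v} = (if v \<in> D then {v} else {})" by auto
      then show ?thesis unfolding degR degS eq by simp
    qed
    then show ?thesis using ex[of v] degD[OF v] by simp
  qed
  have simple: "simple_on V ?H"
  proof -
    have "{u, b} \<in> pairs_on V \<and> {\<phi> b, b} \<in> pairs_on V" if "b \<in> D" for b
      using u(1) A DA[OF that] \<phi>(1)[OF that] by auto
    then have "S1 \<union> S2 \<subseteq> pairs_on V" by (auto simp: S1_def S2_def)
    then show ?thesis using sH by (auto simp: simple_on_def)
  qed
  let ?L = "\<phi> ` D" and ?\<beta> = "inv_into D \<phi>"
  have \<beta>: "?\<beta> (\<phi> b) = b" if "b \<in> D" for b using inj that by simp
  have "star_clique V ?H A u ?L ?\<beta>"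
    unfolding star_clique_def
  proof (intro conjI ballI)
    show "?L \<subseteq> A - {u}" using \<phi> by auto
    show "inj_on ?\<beta> ?L" by (rule inj_on_inv_into) simp
    show "?\<beta> ` ?L \<subseteq> V - A" using \<beta> DA by auto
    show "pairs_on A - (\<lambda>a. {u, a}) ` ?L \<subseteq> ?H"
    proof
      fix e assume e: "e \<in> pairs_on A - (\<lambda>a. {u, a}) ` ?L"
      then have "e \<in> H" "e \<notin> R1" using clA by (auto simp: clique_def R1_def)
      moreover obtain x y where "e = {x, y}" "x \<in> A" using e by (auto simp: pairs_on_def)
      then have "e \<notin> pairs_on D" using D(1) by auto
      then have "e \<notin> M" using M(1) by blast
      ultimately show "e \<in> ?H" by blast
    qed
    fix a assume "a \<in> ?L"
    then obtain b where "b \<in> D" "a = \<phi> b" by blast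
    then show "{u, ?\<beta> a} \<in> ?H" "{a, ?\<beta> a} \<in> ?H" using \<beta> by (auto simp: S1_def S2_def)
  qed (use A u in auto)
  then show ?thesis using simple deg by blast
qed

end

section \<open>Realizing a single part\<close>

lemma top_subset_exists:
  fixes d :: "'a \<Rightarrow> nat"
  assumes "finite V" "k \<le> card V"
  shows "\<exists>A\<subseteq>V. card A = k \<and> (\<forall>a\<in>A. \<forall>b\<in>V - A. d b \<le> d a)"
  using assms(2)
proof (induction k)
  case (Suc k)
  then obtain A where A: "A \<subseteq> V" "card A = k" "\<forall>a\<in>A. \<forall>b\<in>V - A. d b \<le> d a" by auto
  have finA: "finite A" using A(1) assms(1) finite_subset by blast
  have "V - A \<noteq> {}" using A Suc.prems by auto
  then have "Max (d ` (V - A)) \<in> d ` (V - A)" using assms(1) by (intro Max_in) auto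
  then obtain x where x: "x \<in> V - A" "d x = Max (d ` (V - A))" by auto
  then have mx: "d b \<le> d x" if "b \<in> V - A" for b using that assms(1) by auto
  show ?case
    using A x(1) mx finA by (intro exI[of _ "insert x A"]) auto
qed (auto intro: exI[of _ "{}"])

lemma star_clique_realization:
  assumes G: "simple_on V G" and k: "1 \<le> k" "2 * k \<le> card V + 1"
    and mind: "\<And>v. v \<in> V \<Longrightarrow> k \<le> edeg G v + 1"
  shows "\<exists>H A u L \<beta>. simple_on V H \<and> (\<forall>v\<in>V. edeg H v = edeg G v) \<and> card A = k \<and> star_clique V H A u L \<beta>"
proof -
  have finV: "finite V" using G by (simp add: simple_on_def)
  obtain A where A: "A \<subseteq> V" "card A = k" "\<And>a b. a \<in> A \<Longrightarrow> b \<in> V - A \<Longrightarrow> edeg G b \<le> edeg G a"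
    using top_subset_exists[of V k "edeg G"] finV k by auto
  note cA = A(2)
  have "A \<noteq> {}" using A k by auto
  then obtain u where u: "u \<in> A" "\<And>a. a \<in> A \<Longrightarrow> edeg G u \<le> edeg G a"
    using ex_has_least_nat[of "\<lambda>a. a \<in> A" _ "edeg G"] by blast
  consider H where "simple_on V H" "\<forall>v\<in>V. edeg H v = edeg G v" "clique H A"
    | H where "card V + 1 = 2 * card A" "simple_on V H" "\<forall>v\<in>V. edeg H v \<le> edeg G v"
      "\<forall>a\<in>A. edeg H a = edeg G a" "clique H A" "clique H (V - A)"
    using clique_realization_or_split[OF G A(1,3)] mind A(2) k by auto
  then show ?thesis
  proof cases
    case 1
    then have "star_clique V H A u {} id" using A u by (auto simp: star_clique_def clique_def)
    then show ?thesis using 1 A(2) by blast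
  next
    case 2
    interpret split_subrealization V A "edeg G" u
      using finV A u mind k 2(1) even_sum_edeg[OF G] by unfold_locales auto
    have "split_sub H" using 2 by (auto simp: split_sub_def)
    then show ?thesis using star_realization cA by blast
  qed
qed

section \<open>Joining the parts\<close>

lemma star_clique_mono: "star_clique V H A u L \<beta> \<Longrightarrow> H \<subseteq> H' \<Longrightarrow> star_clique V H' A u L \<beta>"
  unfolding star_clique_def by blast

text \<open>An inner edge at \<open>v\<close> can only belong to the part containing
  \<open>v\<close>, so the replacement is compared one part at a time.\<close>

lemma edeg_patch:
  assumes E: "simple_on V E"
    and disj: "\<And>C D. C \<in> \<C> \<Longrightarrow> D \<in> \<C> \<Longrightarrow> C \<noteq> D \<Longrightarrow> C \<inter> D = {}" and sub: "\<And>C. C \<in> \<C> \<Longrightarrow> C \<subseteq> V"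
    and K: "\<And>C. C \<in> \<C> \<Longrightarrow> K C \<subseteq> pairs_on C"
    and deg: "\<And>C v. C \<in> \<C> \<Longrightarrow> v \<in> C \<Longrightarrow> edeg (K C) v = edeg (E \<inter> pairs_on C) v"
  shows "edeg ((E - (\<Union>C\<in>\<C>. pairs_on C)) \<union> (\<Union>C\<in>\<C>. K C)) v = edeg E v"
proof -
  let ?P = "\<Union>C\<in>\<C>. pairs_on C"
  have finP: "finite ?P"
  proof (rule finite_subset)
    show "?P \<subseteq> pairs_on V" using sub pairs_on_mono by blast
    show "finite (pairs_on V)" using E by (simp add: simple_on_def finite_pairs_on)
  qed
  have KP: "(\<Union>C\<in>\<C>. K C) \<subseteq> ?P" using K by blast
  have finE: "finite E" by (rule simple_on_finite[OF E])
  have local: "edeg (\<Union>C\<in>\<C>. J C) v = edeg (J C) v"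
    if J: "\<And>C. C \<in> \<C> \<Longrightarrow> J C \<subseteq> pairs_on C" and C: "C \<in> \<C>" "v \<in> C" for J :: "'a set \<Rightarrow> 'a set set" and C
  proof -
    have "{e \<in> \<Union>C\<in>\<C>. J C. v \<in> e} = {e \<in> J C. v \<in> e}"
    proof (intro equalityI subsetI)
      fix e assume "e \<in> {e \<in> \<Union>C\<in>\<C>. J C. v \<in> e}"
      then obtain D where D: "D \<in> \<C>" "e \<in> J D" "v \<in> e" by blast
      then have "e \<in> pairs_on D" using J by blast
      then have "v \<in> D" using D(3) by (auto simp: pairs_on_def)
      then have "D = C" using disj[OF D(1) C(1)] C(2) by blast
      then show "e \<in> {e \<in> J C. v \<in> e}" using D by simp
    qed (use C in auto)
    then show ?thesis by (simp add: edeg_def)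
  qed
  have eq: "edeg (\<Union>C\<in>\<C>. K C) v = edeg (\<Union>C\<in>\<C>. E \<inter> pairs_on C) v"
  proof (cases "\<exists>C\<in>\<C>. v \<in> C")
    case True
    then obtain C where C: "C \<in> \<C>" "v \<in> C" by blast
    have "edeg (\<Union>C\<in>\<C>. K C) v = edeg (K C) v" by (rule local[OF K C])
    also have "\<dots> = edeg (E \<inter> pairs_on C) v" by (rule deg[OF C])
    also have "\<dots> = edeg (\<Union>C\<in>\<C>. E \<inter> pairs_on C) v"
      by (rule local[symmetric, OF _ C]) auto
    finally show ?thesis .
  next
    case False
    have "v \<notin> e" if "C \<in> \<C>" "e \<in> pairs_on C" for C e
      using that False by (auto simp: pairs_on_def)
    then have "{e \<in> \<Union>C\<in>\<C>. K C. v \<in> e} = {}" "{e \<in> \<Union>C\<in>\<C>. E \<inter> pairs_on C. v \<in> e} = {}"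
      using K by blast+
    then show ?thesis unfolding edeg_def by (simp only:)
  qed
  have "edeg ((E - ?P) \<union> (\<Union>C\<in>\<C>. K C)) v = edeg (E - ?P) v + edeg (\<Union>C\<in>\<C>. K C) v"
    using KP finE finP finite_subset by (intro edeg_union) auto
  also have "\<dots> = edeg (E - ?P) v + edeg (E \<inter> ?P) v"
  proof -
    have "(\<Union>C\<in>\<C>. E \<inter> pairs_on C) = E \<inter> ?P" by blast
    then show ?thesis using eq by (simp only:)
  qed
  also have "\<dots> = edeg ((E - ?P) \<union> (E \<inter> ?P)) v"
    using finE by (intro edeg_union[symmetric]) auto
  also have "(E - ?P) \<union> (E \<inter> ?P) = E" by blast
  finally show ?thesis .
qed

section \<open>Translation to pair digraphs\<close>

definition digraph_of :: "'a set \<Rightarrow> 'a set set \<Rightarrow> 'a pair_pre_digraph" where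
  "digraph_of V E = \<lparr>pverts = V, parcs = {(x, y). {x, y} \<in> E}\<rparr>"

lemma pair_graph_digraph_of:
  assumes "simple_on V E"
  shows "pair_graph (digraph_of V E)"
proof
  fix e assume "e \<in> parcs (digraph_of V E)"
  then show "fst e \<in> pverts (digraph_of V E)" "snd e \<in> pverts (digraph_of V E)" "fst e \<noteq> snd e"
    using simple_onD[OF assms, of "fst e" "snd e"] by (auto simp: digraph_of_def)
next
  show fin: "finite (pverts (digraph_of V E))"
    using assms by (simp add: digraph_of_def simple_on_def)
  have "parcs (digraph_of V E) \<subseteq> V \<times> V" using simple_onD[OF assms] by (auto simp: digraph_of_def)
  then show "finite (parcs (digraph_of V E))"
    using fin finite_subset by (fastforce simp: digraph_of_def)
  show "symmetric (with_proj (digraph_of V E))"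
    unfolding symmetric_def with_proj_simps sym_def by (auto simp: digraph_of_def insert_commute)
qed

lemma out_degree_digraph_of:
  assumes "simple_on V E"
  shows "out_degree (with_proj (digraph_of V E)) v = edeg E v"
proof -
  have "out_arcs (with_proj (digraph_of V E)) v = Pair v ` nbrs E v"
    by (auto simp: out_arcs_def digraph_of_def)
  then show ?thesis
    by (simp add: out_degree_def card_image inj_on_def edeg_eq_card_nbrs[OF assms])
qed

text \<open>The subdividing vertices of a star stay in its own part, so they differ between parts
  and avoid all branch vertices. Edges between branch vertices of different parts come from the join
  and are never subdivided.\<close>

lemma star_subdivision_in_join:
  fixes E :: "'a set set"
  assumes E: "simple_on V E" and fin: "finite \<C>"
    and disj: "\<And>C D. C \<in> \<C> \<Longrightarrow> D \<in> \<C> \<Longrightarrow> C \<noteq> D \<Longrightarrow> C \<inter> D = {}" and sub: "\<And>C. C \<in> \<C> \<Longrightarrow> C \<subseteq> V"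
    and cross: "\<And>C D x y. C \<in> \<C> \<Longrightarrow> D \<in> \<C> \<Longrightarrow> C \<noteq> D \<Longrightarrow> x \<in> C \<Longrightarrow> y \<in> D \<Longrightarrow> {x, y} \<in> E"
    and star: "\<And>C. C \<in> \<C> \<Longrightarrow> star_clique C E (A C) (u C) (L C) (\<beta> C)"
  shows "\<exists>T. subgraph (with_proj T) (with_proj (digraph_of V E)) \<and>
    star_subdivided_complete (\<Sum>C\<in>\<C>. card (A C)) T"
proof -
  have st: "A C \<subseteq> C" "u C \<in> A C" "u C \<in> C" "inj_on (\<beta> C) (L C)" "pairs_on (A C) - (\<lambda>a. {u C, a}) ` L C \<subseteq> E"
    if "C \<in> \<C>" for C using star[OF that] by (auto simp: star_clique_def)
  have stL: "a \<in> A C" "a \<noteq> u C" "a \<in> C" "\<beta> C a \<in> C" "\<beta> C a \<notin> A C" "{u C, \<beta> C a} \<in> E" "{a, \<beta> C a} \<in> E"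
    if "C \<in> \<C>" "a \<in> L C" for C a using star[OF that(1)] that(2) by (auto simp: star_clique_def)
  have same: "C = D" if "C \<in> \<C>" "D \<in> \<C>" "x \<in> C" "x \<in> D" for C D x
    using disj[OF that(1,2)] that(3,4) by blast
  define AA where "AA = (\<Union>C\<in>\<C>. A C)"
  \<comment> \<open>If \<open>L C\<close> is empty this is the single vertex \<open>u C\<close>, a
    star with no edge, so every part contributes a star.\<close>
  define S where "S C = \<lparr>pverts = insert (u C) (L C), parcs = {u C} \<times> L C \<union> L C \<times> {u C}\<rparr>" for C
  define K where "K = \<lparr>pverts = AA, parcs = {(x, y). x \<in> AA \<and> y \<in> AA \<and> x \<noteq> y}\<rparr>"
  define F where "F = (\<Union>S\<in>S ` \<C>. parcs S)"
  \<comment> \<open>\<open>subdivided_once\<close> indexes new vertices by unordered pairs. The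
    choice is unambiguous: disjointness of the parts determines \<open>C\<close> from the pair, and
    \<open>u C\<close>, not being a leaf, then determines \<open>a\<close>.\<close>
  define w where "w e = (SOME x. \<exists>C\<in>\<C>. \<exists>a\<in>L C. e = {u C, a} \<and> x = \<beta> C a)" for e
  define T where "T = \<lparr>pverts = AA \<union> {w {x, y} |x y. (x, y) \<in> F},
    parcs = (parcs K - F) \<union> {(x, w {x, y}) |x y. (x, y) \<in> F} \<union> {(w {x, y}, x) |x y. (x, y) \<in> F}\<rparr>"
  have finV: "finite V" using E by (simp add: simple_on_def)
  have finC: "finite C" if "C \<in> \<C>" for C using sub[OF that] finV finite_subset by blast
  have finA: "finite (A C)" if "C \<in> \<C>" for C using st(1)[OF that] finC[OF that] finite_subset by blast
  have finAA: "finite AA" using fin finA by (auto simp: AA_def)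
  have cardAA: "card AA = (\<Sum>C\<in>\<C>. card (A C))"
    unfolding AA_def using fin finA disj st(1) by (intro card_UN_disjoint) blast+
  have w: "w {u C, a} = \<beta> C a" if C: "C \<in> \<C>" "a \<in> L C" for C a
    unfolding w_def
  proof (rule some_equality)
    show "\<exists>D\<in>\<C>. \<exists>b\<in>L D. {u C, a} = {u D, b} \<and> \<beta> C a = \<beta> D b" using C by blast
    fix x assume "\<exists>D\<in>\<C>. \<exists>b\<in>L D. {u C, a} = {u D, b} \<and> x = \<beta> D b"
    then obtain D b where D: "D \<in> \<C>" "b \<in> L D" "{u C, a} = {u D, b}" "x = \<beta> D b" by blast
    have "u C \<in> {u D, b}" using D(3) by blast
    then have "u C \<in> D" using st(3)[OF D(1)] stL(3)[OF D(1,2)] by auto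
    then have "C = D" using same[OF C(1) D(1) st(3)[OF C(1)]] by blast
    then show "x = \<beta> C a" using D stL(2)[OF C] by (auto simp: doubleton_eq_iff)
  qed
  have F_cases: "\<exists>C\<in>\<C>. \<exists>a\<in>L C. (x, y) = (u C, a) \<or> (x, y) = (a, u C)" if "(x, y) \<in> F" for x y
    using that by (auto simp: F_def S_def)
  have F_elem: "\<exists>C\<in>\<C>. \<exists>a\<in>L C. {x, y} = {u C, a} \<and> w {x, y} = \<beta> C a \<and> x \<in> {u C, a}" if xy: "(x, y) \<in> F" for x y
  proof -
    obtain C a where C: "C \<in> \<C>" "a \<in> L C" "(x, y) = (u C, a) \<or> (x, y) = (a, u C)"
      using F_cases[OF xy] by blast
    then have "{x, y} = {u C, a}" "x \<in> {u C, a}" by auto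
    then show ?thesis using C w[OF C(1,2)] by auto
  qed
  have AA_C: "x \<in> A C" if "x \<in> AA" "x \<in> C" "C \<in> \<C>" for x C
    using that st(1) same unfolding AA_def by blast
  have FK: "F \<subseteq> parcs K"
  proof
    fix e assume "e \<in> F"
    then obtain x y where e: "e = (x, y)" "(x, y) \<in> F" by (cases e) auto
    obtain C a where C: "C \<in> \<C>" "a \<in> L C" "(x, y) = (u C, a) \<or> (x, y) = (a, u C)"
      using F_cases[OF e(2)] by blast
    then show "e \<in> parcs K" using st(2)[OF C(1)] stL(1,2)[OF C(1,2)] e(1) by (auto simp: K_def AA_def)
  qed
  have subd: "subdivided_once K F T"
    unfolding subdivided_once_def
  proof (intro conjI exI[of _ w])
    show "F \<subseteq> parcs K" by (rule FK)
    show "sym F" by (auto simp: sym_def F_def S_def)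
    show "inj_on w {{x, y} |x y. (x, y) \<in> F}"
    proof (rule inj_onI)
      fix e f assume "e \<in> {{x, y} |x y. (x, y) \<in> F}" "f \<in> {{x, y} |x y. (x, y) \<in> F}" and eq: "w e = w f"
      then obtain C a D b where C: "C \<in> \<C>" "a \<in> L C" "e = {u C, a}" "w e = \<beta> C a"
        and D: "D \<in> \<C>" "b \<in> L D" "f = {u D, b}" "w f = \<beta> D b"
        using F_elem by (smt (verit) mem_Collect_eq)
      have "C = D" using same[OF C(1) D(1) stL(4)[OF C(1,2)]] stL(4)[OF D(1,2)] C(4) D(4) eq by simp
      then have "a = b" using C D eq st(4)[OF C(1)] by (auto dest: inj_onD)
      then show "e = f" using C D \<open>C = D\<close> by simp
    qed
    show "\<forall>(x, y)\<in>F. w {x, y} \<notin> pverts K"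
    proof clarify
      fix x y assume xy: "(x, y) \<in> F" "w {x, y} \<in> pverts K"
      obtain C a where C: "C \<in> \<C>" "a \<in> L C" "w {x, y} = \<beta> C a" using F_elem[OF xy(1)] by blast
      then show False using AA_C[of "\<beta> C a" C] stL(4,5)[OF C(1,2)] xy(2) by (simp add: K_def)
    qed
  qed (simp_all add: T_def K_def)
  have arcs_T: "x \<in> pverts T \<and> y \<in> pverts T \<and> {x, y} \<in> E" if xyT: "(x, y) \<in> parcs T" for x y
  proof -
    consider "(x, y) \<in> parcs K - F" | z where "(x, z) \<in> F" "y = w {x, z}" | z where "(y, z) \<in> F" "x = w {y, z}"
      using xyT by (auto simp: T_def)
    then show ?thesis
    proof cases
      case 1
      then have xy: "x \<in> AA" "y \<in> AA" "x \<noteq> y" by (auto simp: K_def)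
      then obtain C D where C: "C \<in> \<C>" "x \<in> A C" and D: "D \<in> \<C>" "y \<in> A D" by (auto simp: AA_def)
      have "{x, y} \<in> E"
      proof (cases "C = D")
        case True
        have "{x, y} \<notin> (\<lambda>a. {u C, a}) ` L C"
        proof
          assume "{x, y} \<in> (\<lambda>a. {u C, a}) ` L C"
          then have "(x, y) \<in> parcs (S C)" by (auto simp: S_def doubleton_eq_iff)
          then show False using 1 C(1) by (auto simp: F_def)
        qed
        then show ?thesis using st(5)[OF C(1)] C(2) D(2) xy(3) True by auto
      next
        case False
        then show ?thesis using cross C D st(1) by blast
      qed
      then show ?thesis using xy by (simp add: T_def)
    next
      case 2
      obtain C a where C: "C \<in> \<C>" "a \<in> L C" "w {x, z} = \<beta> C a" "x \<in> {u C, a}" using F_elem[OF 2(1)] by blast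
      then have "{x, y} \<in> E" using stL(6,7)[OF C(1,2)] 2(2) by auto
      moreover have "x \<in> AA" using FK 2(1) by (auto simp: K_def)
      ultimately show ?thesis using 2 by (auto simp: T_def)
    next
      case 3
      obtain C a where C: "C \<in> \<C>" "a \<in> L C" "w {y, z} = \<beta> C a" "y \<in> {u C, a}" using F_elem[OF 3(1)] by blast
      then have "{x, y} \<in> E" using stL(6,7)[OF C(1,2)] 3(2) by (auto simp: insert_commute)
      moreover have "y \<in> AA" using FK 3(1) by (auto simp: K_def)
      ultimately show ?thesis using 3 by (auto simp: T_def)
    qed
  qed
  have T_V: "pverts T \<subseteq> V"
  proof
    fix x assume "x \<in> pverts T"
    then consider "x \<in> AA" | y z where "(y, z) \<in> F" "x = w {y, z}" by (auto simp: T_def)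
    then show "x \<in> V"
    proof cases
      case 1
      then show ?thesis using st(1) sub by (auto simp: AA_def)
    next
      case 2
      obtain C a where C: "C \<in> \<C>" "a \<in> L C" "w {y, z} = \<beta> C a" using F_elem[OF 2(1)] by blast
      then show ?thesis using stL(4)[OF C(1,2)] sub[OF C(1)] 2(2) by auto
    qed
  qed
  interpret H: pair_graph "digraph_of V E" by (rule pair_graph_digraph_of[OF E])
  have "pair_wf_digraph T" using arcs_T by unfold_locales auto
  then have "subgraph (with_proj T) (with_proj (digraph_of V E))"
    using T_V arcs_T H.pair_wf_digraph_axioms
    by (auto simp: subgraph_def compatible_def wf_digraph_wp_iff digraph_of_def)
  moreover have "star_subdivided_complete (\<Sum>C\<in>\<C>. card (A C)) T"
    unfolding star_subdivided_complete_def
  proof (intro exI[of _ K] exI[of _ "S ` \<C>"] conjI ballI)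
    show complete: "complete_digraph (\<Sum>C\<in>\<C>. card (A C)) (with_proj K)"
      using finAA cardAA by (auto simp: complete_digraph_pair_def K_def)
    have wfK: "pair_wf_digraph K" by unfold_locales (auto simp: K_def)
    fix Q assume "Q \<in> S ` \<C>"
    then obtain C where C: "C \<in> \<C>" "Q = S C" by blast
    have "pair_wf_digraph Q" by unfold_locales (auto simp: C S_def)
    moreover have "pverts Q \<subseteq> pverts K" using C st(2) stL(1) by (auto simp: S_def K_def AA_def)
    moreover have "parcs Q \<subseteq> parcs K" using FK C by (auto simp: F_def)
    ultimately show "subgraph (with_proj Q) (with_proj K)"
      using wfK by (simp add: subgraph_def compatible_def wf_digraph_wp_iff)
    have finL: "finite (L C)" using stL(1)[OF C(1)] finA[OF C(1)] by (meson finite_subset subsetI)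
    have "u C \<notin> L C" using stL(2)[OF C(1)] by blast
    then have "pverts Q = {u C} \<union> L C \<and> {u C} \<inter> L C = {} \<and> card {u C} = 1 \<and> card (L C) = card (L C) \<and>
        parcs Q = {u C} \<times> L C \<union> L C \<times> {u C}"
      by (simp add: C S_def)
    moreover have "finite (pverts Q)" using finL by (simp add: C S_def)
    ultimately show "\<exists>n. complete_bipartite_digraph 1 n (with_proj Q)"
      unfolding complete_bipartite_digraph_pair_def by blast
  next
    show "pairwise (\<lambda>S S'. pverts S \<inter> pverts S' = {}) (S ` \<C>)"
    proof (rule pairwiseI)
      fix P Q assume "P \<in> S ` \<C>" "Q \<in> S ` \<C>" "P \<noteq> Q"
      then obtain C D where C: "C \<in> \<C>" "P = S C" and D: "D \<in> \<C>" "Q = S D" "C \<noteq> D" by blast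
      have "pverts P \<subseteq> C" "pverts Q \<subseteq> D"
        using C D st(3) stL(3) by (auto simp: S_def)
      then show "pverts P \<inter> pverts Q = {}" using disj[OF C(1) D(1,3)] by blast
    qed
    show "subdivided_once K (\<Union>S\<in>S ` \<C>. parcs S) T" using subd by (simp add: F_def)
  qed
  ultimately show ?thesis by blast
qed

text \<open>A vertex-critical \<open>W\<close> with the full chromatic number suffices: only edges
  inside its join parts are exchanged, so edges between parts, or meeting \<open>V - W\<close>,
  survive.\<close>

lemma realization_with_star_subdivision:
  assumes E: "simple_on V E"
  shows "\<exists>E'. simple_on V E' \<and> (\<forall>v\<in>V. edeg E' v = edeg E v) \<and>
    (\<exists>T. subgraph (with_proj T) (with_proj (digraph_of V E')) \<and> star_subdivided_complete (chi E V) T)"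
proof -
  have finV: "finite V" using E by (simp add: simple_on_def)
  interpret loopfree E using E by unfold_locales (auto simp: simple_on_def)
  obtain W where W: "W \<subseteq> V" "vertex_critical E W" "chi E W = chi E V"
    using critical_subset[OF finV order_refl] by blast
  have finW: "finite W" using W(1) finV finite_subset by blast
  obtain \<C> where C: "\<Union>\<C> = W" "pairwise (joined E) \<C>"
    "\<And>C. C \<in> \<C> \<Longrightarrow> join_irreducible E C" "\<And>C. C \<in> \<C> \<Longrightarrow> vertex_critical E C"
    using critical_join_decomposition[OF finW W(2)] by blast
  have CW: "C \<subseteq> W" if "C \<in> \<C>" for C using that C(1) by blast
  have finC: "finite C" if "C \<in> \<C>" for C using CW[OF that] finW finite_subset by blast
  have fin\<C>: "finite \<C>" using C(1) finW finite_UnionD by blast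
  have disj: "C \<inter> D = {}" if "C \<in> \<C>" "D \<in> \<C>" "C \<noteq> D" for C D
    using pairwiseD[OF C(2) that] by (simp add: joined_def)
  have cross: "{x, y} \<in> E" if "C \<in> \<C>" "D \<in> \<C>" "C \<noteq> D" "x \<in> C" "y \<in> D" for C D x y
    using pairwiseD[OF C(2) that(1-3)] that(4,5) by (simp add: joined_def)
  have ex: "\<exists>H A u L \<beta>. simple_on C H \<and> (\<forall>v\<in>C. edeg H v = edeg (E \<inter> pairs_on C) v) \<and>
      card A = chi E C \<and> star_clique C H A u L \<beta>" if CC: "C \<in> \<C>" for C
  proof (rule star_clique_realization)
    show s: "simple_on C (E \<inter> pairs_on C)" using finC[OF CC] by (simp add: simple_on_def)
    have ne: "C \<noteq> {}" using C(3)[OF CC] by (simp add: join_irreducible_def)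
    then obtain v where "v \<in> C" by blast
    then show "1 \<le> chi E C" using C(4)[OF CC] unfolding vertex_critical_def by fastforce
    show "2 * chi E C \<le> card C + 1" using finC[OF CC] C(3,4)[OF CC] by (intro gallai_critical_card)
    fix v assume v: "v \<in> C"
    have "{w \<in> C. {v, w} \<in> E} = nbrs (E \<inter> pairs_on C) v" using v no_loop[of v] by auto
    then show "chi E C \<le> edeg (E \<inter> pairs_on C) v + 1"
      using degree_ge_of_critical[OF finC[OF CC] C(4)[OF CC] v] by (simp add: edeg_eq_card_nbrs[OF s])
  qed
  then obtain K A u L \<beta> where K: "\<And>C. C \<in> \<C> \<Longrightarrow> simple_on C (K C)"
    "\<And>C v. C \<in> \<C> \<Longrightarrow> v \<in> C \<Longrightarrow> edeg (K C) v = edeg (E \<inter> pairs_on C) v"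
    "\<And>C. C \<in> \<C> \<Longrightarrow> card (A C) = chi E C"
    "\<And>C. C \<in> \<C> \<Longrightarrow> star_clique C (K C) (A C) (u C) (L C) (\<beta> C)"
    by metis
  define E' where "E' = (E - (\<Union>C\<in>\<C>. pairs_on C)) \<union> (\<Union>C\<in>\<C>. K C)"
  have Ksub: "K C \<subseteq> pairs_on C" if "C \<in> \<C>" for C using K(1)[OF that] by (simp add: simple_on_def)
  have CV: "C \<subseteq> V" if "C \<in> \<C>" for C using CW[OF that] W(1) by blast
  have sE': "simple_on V E'"
  proof -
    have "K C \<subseteq> pairs_on V" if "C \<in> \<C>" for C
      using Ksub[OF that] pairs_on_mono[OF CV[OF that]] by blast
    then show ?thesis using E by (auto simp: simple_on_def E'_def)
  qed
  have deg: "edeg E' v = edeg E v" for v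
    unfolding E'_def using E disj CV Ksub K(2) by (rule edeg_patch)
  have "\<exists>T. subgraph (with_proj T) (with_proj (digraph_of V E')) \<and>
    star_subdivided_complete (\<Sum>C\<in>\<C>. card (A C)) T"
  proof (rule star_subdivision_in_join[OF sE' fin\<C> disj CV])
    fix C D x y assume xy: "C \<in> \<C>" "D \<in> \<C>" "C \<noteq> D" "x \<in> C" "y \<in> D"
    have "{x, y} \<notin> pairs_on Q" if "Q \<in> \<C>" for Q
      using disj[OF xy(1) that] disj[OF xy(2) that] xy by auto
    then show "{x, y} \<in> E'" using cross[OF xy] by (auto simp: E'_def)
  next
    fix C assume CC: "C \<in> \<C>"
    show "star_clique C E' (A C) (u C) (L C) (\<beta> C)"
      by (rule star_clique_mono[OF K(4)[OF CC]]) (use CC in \<open>auto simp: E'_def\<close>)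
  qed
  moreover have "(\<Sum>C\<in>\<C>. card (A C)) = chi E V"
    using K(3) chi_Union_join[OF fin\<C> finC C(2)] C(1) W(3) by simp
  ultimately show ?thesis using sE' deg by auto
qed

theorem theorem4p1:
  fixes G :: "'a pair_pre_digraph"
  assumes "pair_graph G"
  shows "chromatic_number G \<le> h1_seq (degree_sequence G)"
proof -
  interpret G: pair_graph G by fact
  obtain f :: "'a \<Rightarrow> nat" where f: "inj_on f (pverts G)"
    using finite_imp_inj_to_nat_seg[OF G.pair_finite_verts] by blast
  \<comment> \<open>\<open>realizations\<close> consists of graphs on natural numbers, so
    \<open>G\<close> is first copied there along \<open>f\<close>.\<close>
  define V where "V = f ` pverts G"
  define E where "E = (\<lambda>(x, y). {f x, f y}) ` parcs G"
  have s: "sym (parcs G)" using G.pair_sym_arcs by (simp add: symmetric_def)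
  have arc: "x \<in> pverts G" "y \<in> pverts G" "x \<noteq> y" if "(x, y) \<in> parcs G" for x y
    using that G.in_arcsD1 G.in_arcsD2 G.pair_no_loops[of "(x, y)"] by auto
  have E_iff: "{f x, f y} \<in> E \<longleftrightarrow> (x, y) \<in> parcs G" if xy: "x \<in> pverts G" "y \<in> pverts G" for x y
  proof
    assume "{f x, f y} \<in> E"
    then obtain a b where ab: "(a, b) \<in> parcs G" "{f x, f y} = {f a, f b}" by (auto simp: E_def)
    then have "x = a \<and> y = b \<or> x = b \<and> y = a"
      using inj_onD[OF f] xy arc[OF ab(1)] by (auto simp: doubleton_eq_iff)
    then show "(x, y) \<in> parcs G" using ab(1) s by (auto dest: symD)
  qed (auto simp: E_def)
  have sE: "simple_on V E"
  proof -
    have "{f x, f y} \<in> pairs_on V" if "(x, y) \<in> parcs G" for x y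
      using arc[OF that] inj_onD[OF f, of x y] by (auto simp: V_def)
    then have "E \<subseteq> pairs_on V" by (auto simp: E_def)
    then show ?thesis using G.pair_finite_verts by (simp add: simple_on_def V_def)
  qed
  interpret loopfree E using sE by unfold_locales (auto simp: simple_on_def)
  have finV: "finite V" using sE by (simp add: simple_on_def)
  have "\<exists>c. proper_coloring G (chi E V) c"
  proof -
    obtain c where c: "\<forall>v\<in>V. c v < chi E V" "\<forall>x\<in>V. \<forall>y\<in>V. {x, y} \<in> E \<longrightarrow> c x \<noteq> c y"
      using colorable_chi[OF finV] unfolding colorable_def by blast
    have "proper_coloring G (chi E V) (c \<circ> f)"
      unfolding proper_coloring_def
    proof (intro conjI ballI)
      show "(c \<circ> f) v < chi E V" if "v \<in> pverts G" for v using c(1) that by (simp add: V_def)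
      fix e assume e: "e \<in> parcs G"
      obtain x y where xy: "e = (x, y)" by (cases e)
      have "{f x, f y} \<in> E" "f x \<in> V" "f y \<in> V" using e xy arc[of x y] by (auto simp: E_def V_def)
      then show "case e of (x, y) \<Rightarrow> (c \<circ> f) x \<noteq> (c \<circ> f) y" using c(2) xy by simp
    qed
    then show ?thesis by blast
  qed
  then have chi: "chromatic_number G \<le> chi E V" unfolding chromatic_number_def by (rule Least_le)
  obtain E' T where E': "simple_on V E'" "\<And>v. v \<in> V \<Longrightarrow> edeg E' v = edeg E v"
    and T: "subgraph (with_proj T) (with_proj (digraph_of V E'))" "star_subdivided_complete (chi E V) T"
    using realization_with_star_subdivision[OF sE] by blast
  let ?H = "digraph_of V E'"
  have H: "pair_graph ?H" by (rule pair_graph_digraph_of[OF E'(1)])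
  have deg: "edeg E (f v) = out_degree (with_proj G) v" if v: "v \<in> pverts G" for v
  proof -
    have "nbrs E (f v) = f ` {y. (v, y) \<in> parcs G}"
    proof (intro equalityI subsetI)
      fix z assume z: "z \<in> nbrs E (f v)"
      then have "z \<in> V" using simple_onD(2)[OF sE] by simp
      then obtain y where y: "y \<in> pverts G" "z = f y" by (auto simp: V_def)
      then show "z \<in> f ` {y. (v, y) \<in> parcs G}" using z E_iff[OF v y(1)] by auto
    qed (auto simp: E_def)
    moreover have "inj_on f {y. (v, y) \<in> parcs G}"
      by (rule inj_on_subset[OF f]) (use arc in auto)
    moreover have "out_arcs (with_proj G) v = Pair v ` {y. (v, y) \<in> parcs G}"
      by (auto simp: out_arcs_def)
    ultimately show ?thesis
      by (simp add: edeg_eq_card_nbrs[OF sE] out_degree_def card_image inj_on_def)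
  qed
  have "degree_sequence ?H = image_mset (edeg E') (mset_set V)"
  proof -
    have "out_degree (with_proj ?H) = edeg E'" using out_degree_digraph_of[OF E'(1)] by (rule ext)
    moreover have "pverts ?H = V" by (simp add: digraph_of_def)
    ultimately show ?thesis by (simp add: degree_sequence_def)
  qed
  also have "\<dots> = image_mset (edeg E) (mset_set V)"
    using E'(2) finV by (intro image_mset_cong) auto
  also have "\<dots> = degree_sequence G"
    using deg G.pair_finite_verts
    by (auto simp: degree_sequence_def V_def image_mset_mset_set[OF f, symmetric]
        multiset.map_comp intro!: image_mset_cong)
  finally have real: "?H \<in> realizations (degree_sequence G)" using H by (simp add: realizations_def)
  have "chi E V \<le> h1 ?H"
    unfolding h1_def using h1_candidates(1)[OF H] T by (intro Max_ge) auto
  also have "h1 ?H \<le> h1_seq (degree_sequence G)"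
    unfolding h1_seq_def using finite_h1_realizations real by (intro Max_ge) auto
  finally show ?thesis using chi by simp
qed

end
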